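(* Let $a(x,s,\xi)=\tilde a(x,\xi)b(s)$, where $\tilde a$ satisfies (U) and $b:\mathbb{R}\to\mathbb{R}$ is bounded, Lipschitz and satisfies (B). Let $h$ be strictly decreasing and satisfy (H2). Let $f\in L^m(\Omega)$, $m\ge1$, with $f>0$ a.e. in $\Omega$. Then the following hold. (a) If $\theta\le\frac{\gamma_2}{p-1}$ and $m=1$, there is at most one entropy solution to (P). (b) If $\theta>\frac{\gamma_2}{p-1}$ and $m>1$, there is at most one entropy solution $u$ to (P) such that $u^{\frac{m(\theta(p-1)-\gamma_2)}{m-1}}\in L^1(\Omega)$. (c) If moreover $0\le\theta\le1+\frac{\gamma_2}{p-1}$ and $$m\ge\max\Big(\frac{N(p-1)}{(N-p)(\gamma_2-\theta(p-1))+N(p-1)},\,1\Big),$$ then there is at most one entropy solution to (P).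
   Context: Let $\Omega\subset\mathbb{R}^N$, $N\ge2$, be a bounded open set and $1<p<N$. For $k>0$, $T_k(s)=\max(-k,\min(s,k))$. (U) The function $\tilde a:\Omega\times\mathbb{R}^N\to\mathbb{R}^N$ is Carathéodory and, for a.e. $x$ and all $\xi\ne\xi'$: - $\tilde a(x,\xi)\cdot\xi\ge|\xi|^p$; - $|\tilde a(x,\xi)|\le\beta(\ell(x)+|\xi|^{p-1})$ for some $\beta>0$ and $0\le\ell\in L^{p/(p-1)}(\Omega)$; - $(\tilde a(x,\xi)-\tilde a(x,\xi'))\cdot(\xi-\xi')>0$. (B) $b(s)\ge\alpha(1+|s|)^{-\theta(p-1)}$ for some $\alpha>0$ and $\theta\ge0$. The function $h:[0,\infty)\to[0,\infty]$ is continuous and finite on $(0,\infty)$. (H2) There exist $\gamma_2\ge0$ and $c_2,s_2>0$ with $h(s)\le c_2s^{-\gamma_2}$ for $s\ge s_2$. Problem (P) is: $-\operatorname{div}(a(x,u,\nabla u))=h(u)f$ in $\Omega$, $u\ge0$, $u=0$ on $\partial\Omega$. Gradient convention: for measurable $u$ with $T_k(u)\in W^{1,1}_{loc}(\Omega)$ for all $k$, $\nabla u$ is the unique measurable $v$ with $\nabla T_k(u)=v\chi_{\{|u|\le k\}}$ a.e. for all $k>0$. Entropy solution of (P): a nonnegative measurable a.e. finite $u$ such that for every $k>0$ and every $\varphi\in W^{1,p}_0(\Omega)\cap L^\infty(\Omega)$: - $T_k(u)\in W^{1,p}_0(\Omega)$; - $a(x,T_k(u),\nabla T_k(u))\in L^{p/(p-1)}(\Omega)^N$;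 - $h(u)fT_k(u-\varphi)\in L^1(\Omega)$; - $\int_\Omega a(x,u,\nabla u)\cdot\nabla T_k(u-\varphi)\le\int_\Omega h(u)fT_k(u-\varphi)$. *)

theory Defs
  imports "HOL-Analysis.Analysis"
begin

definition trunc :: "real \<Rightarrow> real \<Rightarrow> real" where
  "trunc k s = max (-k) (min s k)"

fun Ck_fun :: "nat \<Rightarrow> ('a::euclidean_space \<Rightarrow> real) \<Rightarrow> bool" where
  "Ck_fun 0 \<phi> = continuous_on UNIV \<phi>"
| "Ck_fun (Suc k) \<phi> = (\<exists>d\<phi>. (\<forall>x. (\<phi> has_derivative (\<lambda>h. d\<phi> x \<bullet> h)) (at x))
                          \<and> (\<forall>i\<in>Basis. Ck_fun k (\<lambda>x. d\<phi> x \<bullet> i)))"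

definition smooth_fun :: "('a::euclidean_space \<Rightarrow> real) \<Rightarrow> bool" where
  "smooth_fun \<phi> \<longleftrightarrow> (\<forall>k. Ck_fun k \<phi>)"

definition test_fun :: "'a::euclidean_space set \<Rightarrow> ('a \<Rightarrow> real) \<Rightarrow> bool" where
  "test_fun \<Omega> \<phi> \<longleftrightarrow> smooth_fun \<phi> \<and> compact (closure {x. \<phi> x \<noteq> 0})
                      \<and> closure {x. \<phi> x \<noteq> 0} \<subseteq> \<Omega>"

definition is_grad :: "('a::euclidean_space \<Rightarrow> real) \<Rightarrow> ('a \<Rightarrow> 'a) \<Rightarrow> bool" where
  "is_grad \<phi> d\<phi> \<longleftrightarrow> (\<forall>x. (\<phi> has_derivative (\<lambda>h. d\<phi> x \<bullet> h)) (at x))"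

definition Lp_fun :: "'b measure \<Rightarrow> real \<Rightarrow> ('b \<Rightarrow> 'c::{banach,second_countable_topology}) \<Rightarrow> bool" where
  "Lp_fun M p u \<longleftrightarrow> u \<in> borel_measurable M \<and> integrable M (\<lambda>x. norm (u x) powr p)"

definition weak_grad :: "'a::euclidean_space set \<Rightarrow> ('a \<Rightarrow> real) \<Rightarrow> ('a \<Rightarrow> 'a) \<Rightarrow> bool" where
  "weak_grad \<Omega> u g \<longleftrightarrow>
     (\<forall>K. compact K \<and> K \<subseteq> \<Omega> \<longrightarrow> integrable (lebesgue_on K) u \<and> integrable (lebesgue_on K) g)
   \<and> (\<forall>\<phi> d\<phi>. test_fun \<Omega> \<phi> \<and> is_grad \<phi> d\<phi> \<longrightarrow>
        integral\<^sup>L (lebesgue_on \<Omega>) (\<lambda>x. u x *\<^sub>R d\<phi> x)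
          = - integral\<^sup>L (lebesgue_on \<Omega>) (\<lambda>x. \<phi> x *\<^sub>R g x))"

definition W01p0 :: "'a::euclidean_space set \<Rightarrow> real \<Rightarrow> ('a \<Rightarrow> real) \<Rightarrow> ('a \<Rightarrow> 'a) \<Rightarrow> bool" where
  "W01p0 \<Omega> p u g \<longleftrightarrow>
     Lp_fun (lebesgue_on \<Omega>) p u \<and> Lp_fun (lebesgue_on \<Omega>) p g \<and> weak_grad \<Omega> u g
   \<and> (\<exists>\<phi>s d\<phi>s. (\<forall>n. test_fun \<Omega> (\<phi>s n) \<and> is_grad (\<phi>s n) (d\<phi>s n))
        \<and> (\<lambda>n. integral\<^sup>L (lebesgue_on \<Omega>) (\<lambda>x. \<bar>\<phi>s n x - u x\<bar> powr p)) \<longlonglongrightarrow> 0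
        \<and> (\<lambda>n. integral\<^sup>L (lebesgue_on \<Omega>) (\<lambda>x. norm (d\<phi>s n x - g x) powr p)) \<longlonglongrightarrow> 0)"

definition ereal_L1 :: "'b measure \<Rightarrow> ('b \<Rightarrow> ereal) \<Rightarrow> bool" where
  "ereal_L1 M H \<longleftrightarrow> H \<in> borel_measurable M \<and> (AE x in M. \<bar>H x\<bar> \<noteq> \<infinity>)
                    \<and> integrable M (\<lambda>x. real_of_ereal (H x))"

text \<open>Entropy solution of -div(a(x,u,\<nabla>u)) = h(u) f, with a(x,s,\<xi>) = b(s) A(x,\<xi>).
  v plays the role of the generalized gradient \<nabla>u.\<close>
definition entropy_solution ::
  "'a::euclidean_space set \<Rightarrow> real \<Rightarrow> ('a \<Rightarrow> 'a \<Rightarrow> 'a) \<Rightarrow> (real \<Rightarrow> real)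
     \<Rightarrow> (real \<Rightarrow> ereal) \<Rightarrow> ('a \<Rightarrow> real) \<Rightarrow> ('a \<Rightarrow> real) \<Rightarrow> bool" where
  "entropy_solution \<Omega> p A b h f u \<longleftrightarrow>
     u \<in> borel_measurable (lebesgue_on \<Omega>) \<and> (AE x in lebesgue_on \<Omega>. 0 \<le> u x)
   \<and> (\<exists>v. v \<in> borel_measurable (lebesgue_on \<Omega>) \<and>
       (\<forall>k>0.
          W01p0 \<Omega> p (\<lambda>x. trunc k (u x)) (\<lambda>x. if \<bar>u x\<bar> \<le> k then v x else 0)
        \<and> Lp_fun (lebesgue_on \<Omega>) (p / (p - 1))
            (\<lambda>x. b (trunc k (u x)) *\<^sub>R A x (if \<bar>u x\<bar> \<le> k then v x else 0))
        \<and> (\<forall>\<phi> \<psi>. W01p0 \<Omega> p \<phi> \<psi> \<and> (\<exists>M. AE x in lebesgue_on \<Omega>. \<bar>\<phi> x\<bar> \<le> M) \<longrightarrow>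
             ereal_L1 (lebesgue_on \<Omega>) (\<lambda>x. h (u x) * ereal (f x * trunc k (u x - \<phi> x)))
           \<and> integral\<^sup>L (lebesgue_on \<Omega>)
               (\<lambda>x. b (u x) * (A x (v x) \<bullet> (if \<bar>u x - \<phi> x\<bar> \<le> k then v x - \<psi> x else 0)))
             \<le> integral\<^sup>L (lebesgue_on \<Omega>)
               (\<lambda>x. real_of_ereal (h (u x) * ereal (f x * trunc k (u x - \<phi> x)))))))"

end

(* Weak-type Sobolev: the mean g(R) of v over the cube x + R[0,1]^N satisfies |g'(R)| <= N mean |dv|.
   Integrating g' over (R, oo) bounds g(R) pointwise, integrating it over (0, R) bounds v - g(R)
   after Markov and Fubini; optimising R gives t^p |{|v| > t}|^(1 - p/N) <= S ||dv||_p^p.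

   Uniqueness: test the inequality of u1 with T_j(u2), that of u2 with T_j(u1), and add. On
   {u1, u2 <= j} the gradient terms are bounded below by the Lipschitz remainder of b, supported on
   {0 < |u1 - u2| <= k}, and the source terms give (h(u1) - h(u2)) f T_k(u1 - u2) <= 0. Elsewhere only
   the cross terms with u1, u2 within k of j survive. Averaging over the levels j = n + ik with
   0 <= i < n/k makes the bands disjoint, so the cross terms are at most a constant times
   (1/n) * (energy of both solutions on {n/2 < u <= 2n}). Letting k -> 0 and then n -> oo, strict
   monotonicity of h forces u1 = u2, provided the energy term vanishes in the limit.

   With sigma = theta(p-1) - gamma_2, testing with T_t(u) bounds (1/t) * (energy on {t < u <= 4t}) by
   a constant times t^sigma int_{u>t} f. This tends to 0 trivially in case (a) and by the integrability
   of u in case (b). In case (c) the weak Sobolev inequality for T_2t(u) - T_t(u) bounds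
   (2t)^(p-1) |{u > 2t}|^(1 - p/N) by that same quantity, and Hoelder turns this into a contracting
   recurrence along t = 2^i. *)
theory Submission
  imports Defs
begin

text \<open>The dependence of \<open>b\<close> on \<open>u\<close> destroys monotonicity of the
  operator, and test functions must be bounded, so each solution can be compared only with a
  truncation of the other. Both defects compete with a source gap of size k, because T_k dominates k
  T_1 in modulus for k <= 1. The Lipschitz remainder also has size k, but on a set that shrinks to
  the empty set, so it disappears after division by k. The cross terms at a single level carry no
  factor k, and nothing says that the energy in one thin band is of order k; averaging replaces that
  missing information, since disjoint bands together hold no more than the energy of the whole
  strip. A weak-type Sobolev inequality is enough because the decay argument measures only
  superlevel sets. In case (c) no bound on t^sigma int_{u>t} f is known in advance: the recurrence
  is affine with a coefficient tending to 0, and so supplies the bound itself.\<close>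

section \<open>Weak-type Sobolev inequality\<close>

text \<open>An elementary substitute for Jensen's and Hoelder's inequalities, up to a factor 2 after
  optimising in \<open>s\<close>.\<close>
lemma le_add_powr:
  fixes a s p :: real
  assumes "0 \<le> a" "0 < s" "1 \<le> p"
  shows "a \<le> s + s powr (1 - p) * a powr p"
proof (cases "a \<le> s")
  case True
  have "0 \<le> s powr (1 - p) * a powr p" by simp
  then show ?thesis using True by linarith
next
  case False
  then have "a > 0" using assms by linarith
  have "s powr (p - 1) \<le> a powr (p - 1)"
    using False assms by (intro powr_mono2) auto
  then have "1 \<le> a powr (p - 1) / s powr (p - 1)"
    using assms by (simp add: le_divide_eq)
  then have "a \<le> a * (a powr (p - 1) / s powr (p - 1))"
    using \<open>a > 0\<close> mult_left_mono[of 1 "a powr (p - 1) / s powr (p - 1)" a] by simp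
  also have "\<dots> = s powr (1 - p) * a powr p"
    using \<open>a > 0\<close> assms by (simp add: powr_diff field_simps)
  finally show ?thesis using assms by linarith
qed

section \<open>Averages over growing cubes and their derivative in the side length\<close>

lemma norm_le_DIM_unit_cube:
  fixes z :: "'a::euclidean_space"
  assumes "z \<in> cbox 0 One"
  shows "norm z \<le> real DIM('a)"
proof -
  have "norm z \<le> (\<Sum>b\<in>Basis. \<bar>z \<bullet> b\<bar>)" by (rule norm_le_l1)
  also have "\<dots> \<le> (\<Sum>b\<in>(Basis::'a set). 1)"
    using assms by (intro sum_mono) (auto simp: mem_box)
  finally show ?thesis by simp
qed

lemma content_unit_cube [simp]: "measure lborel (cbox (0::'a::euclidean_space) One) = 1"
  by (subst content_cbox) auto

text \<open>This is the mean over the cube with corner \<open>x\<close> and side \<open>R\<close>,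
  pulled back to the fixed unit cube: no division by the volume occurs, \<open>R = 0\<close> is
  allowed and gives \<open>g x\<close>, and differentiation in \<open>R\<close> falls on
  \<open>g\<close> alone.\<close>

definition cube_avg :: "('a::euclidean_space \<Rightarrow> 'b::euclidean_space) \<Rightarrow> 'a \<Rightarrow> real \<Rightarrow> 'b" where
  "cube_avg g x R = integral (cbox 0 One) (\<lambda>z. g (x + R *\<^sub>R z))"

lemma cube_integrable:
  fixes g :: "'a::euclidean_space \<Rightarrow> 'b::euclidean_space"
  assumes "continuous_on UNIV g"
  shows "(\<lambda>z. g (x + R *\<^sub>R z)) integrable_on cbox 0 One"
  by (intro integrable_continuous continuous_on_compose2[OF assms] continuous_intros) auto

lemma cube_avg_0: "cube_avg g x 0 = g x"
  by (simp add: cube_avg_def)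

lemma cube_avg_nonneg:
  fixes g :: "'a::euclidean_space \<Rightarrow> real"
  assumes "continuous_on UNIV g" "\<And>y. 0 \<le> g y"
  shows "0 \<le> cube_avg g x R"
  unfolding cube_avg_def by (intro integral_nonneg cube_integrable assms)

lemma continuous_on_cube_avg:
  fixes g :: "'a::euclidean_space \<Rightarrow> 'b::euclidean_space"
  assumes "continuous_on UNIV g"
  shows "continuous_on T (cube_avg g x)"
proof -
  have "continuous_on (T \<times> cbox 0 One) (\<lambda>(R, z). g (x + R *\<^sub>R z))"
    unfolding split_beta
    by (intro continuous_on_compose2[OF assms] continuous_intros) auto
  from integral_continuous_on_param[OF this] show ?thesis
    unfolding cube_avg_def .
qed

lemma cube_avg_eq_nn_integral:
  fixes g :: "'a::euclidean_space \<Rightarrow> real"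
  assumes "continuous_on UNIV g" "\<And>y. 0 \<le> g y"
  shows "ennreal (cube_avg g x R)
     = (\<integral>\<^sup>+z. ennreal (g (x + R *\<^sub>R z)) * indicator (cbox 0 One) z \<partial>lborel)"
  unfolding cube_avg_def
  by (rule nn_integral_has_integral_lebesgue'[symmetric])
    (use assms in \<open>auto intro!: integrable_integral cube_integrable\<close>)

lemma nn_integral_lborel_shift_scale:
  fixes g :: "'a::euclidean_space \<Rightarrow> ennreal"
  assumes [measurable]: "g \<in> borel_measurable borel" and "R > 0"
  shows "(\<integral>\<^sup>+z. g (x + R *\<^sub>R z) \<partial>lborel) = ennreal (R powr - real DIM('a)) * (\<integral>\<^sup>+y. g y \<partial>lborel)"
proof -
  have "(\<integral>\<^sup>+y. g y \<partial>lborel) = (\<integral>\<^sup>+y. g y \<partial>density (distr lborel borel (\<lambda>z. x + R *\<^sub>R z)) (\<lambda>_. \<bar>R\<bar>^DIM('a)))"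
    using lborel_affine[of R x] assms(2) by simp
  also have "\<dots> = (\<integral>\<^sup>+z. ennreal (\<bar>R\<bar>^DIM('a)) * g (x + R *\<^sub>R z) \<partial>lborel)"
    by (simp add: nn_integral_density nn_integral_distr)
  also have "\<dots> = ennreal (R^DIM('a)) * (\<integral>\<^sup>+z. g (x + R *\<^sub>R z) \<partial>lborel)"
    using assms(2) by (simp add: nn_integral_cmult)
  finally have *: "(\<integral>\<^sup>+y. g y \<partial>lborel) = ennreal (R^DIM('a)) * (\<integral>\<^sup>+z. g (x + R *\<^sub>R z) \<partial>lborel)" .
  have "ennreal (R powr - real DIM('a)) * ennreal (R^DIM('a)) = 1"
    using assms(2) by (simp add: ennreal_mult[symmetric] powr_minus powr_realpow)
  then show ?thesis
    unfolding * mult.assoc[symmetric] by simp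
qed

lemma cube_avg_le_integral:
  fixes g :: "'a::euclidean_space \<Rightarrow> real"
  assumes g: "continuous_on UNIV g" "\<And>y. 0 \<le> g y" and "R > 0" "0 \<le> K"
    and K: "(\<integral>\<^sup>+y. ennreal (g y) \<partial>lborel) \<le> ennreal K"
  shows "cube_avg g x R \<le> R powr - real DIM('a) * K"
proof -
  have [measurable]: "g \<in> borel_measurable borel"
    using g(1) by (rule borel_measurable_continuous_onI)
  have "ennreal (cube_avg g x R) \<le> (\<integral>\<^sup>+z. ennreal (g (x + R *\<^sub>R z)) \<partial>lborel)"
    unfolding cube_avg_eq_nn_integral[OF g]
    by (intro nn_integral_mono) (auto simp: indicator_def)
  also have "\<dots> = ennreal (R powr - real DIM('a)) * (\<integral>\<^sup>+y. ennreal (g y) \<partial>lborel)"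
    using \<open>R > 0\<close> by (intro nn_integral_lborel_shift_scale) auto
  also have "\<dots> \<le> ennreal (R powr - real DIM('a)) * ennreal K"
    by (intro mult_left_mono K) auto
  also have "\<dots> = ennreal (R powr - real DIM('a) * K)"
    using \<open>0 \<le> K\<close> by (simp add: ennreal_mult)
  finally show ?thesis using \<open>0 \<le> K\<close> by (subst (asm) ennreal_le_iff) auto
qed

lemma cube_avg_deriv:
  fixes v :: "'a::euclidean_space \<Rightarrow> real"
  assumes D: "\<And>x. (v has_derivative (\<lambda>h. dv x \<bullet> h)) (at x)" and dv: "continuous_on UNIV dv"
  shows "(cube_avg v x has_vector_derivative integral (cbox 0 One) (\<lambda>z. dv (x + R *\<^sub>R z) \<bullet> z)) (at R)"
  unfolding cube_avg_def
proof (rule leibniz_rule_vector_derivative[where U=UNIV, simplified])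
  have v: "continuous_on UNIV v"
    using D by (meson continuous_at_imp_continuous_on has_derivative_continuous)
  fix R :: real
  show "(\<lambda>z. v (x + R *\<^sub>R z)) integrable_on cbox 0 One"
    by (rule cube_integrable[OF v])
  fix z :: 'a
  have "((\<lambda>R. x + R *\<^sub>R z) has_derivative (\<lambda>r. r *\<^sub>R z)) (at R)"
    by (auto intro!: derivative_eq_intros)
  from has_derivative_compose[OF this D]
  show "((\<lambda>R. v (x + R *\<^sub>R z)) has_vector_derivative dv (x + R *\<^sub>R z) \<bullet> z) (at R)"
    by (simp add: has_vector_derivative_def)
next
  show "continuous_on (UNIV \<times> cbox 0 One) (\<lambda>(R, z). dv (x + R *\<^sub>R z) \<bullet> z)"
    unfolding split_beta
    by (intro continuous_intros continuous_on_compose2[OF dv]) auto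
qed

text \<open>The parameter \<open>s\<close> stays free because the two applications choose it
  differently: depending on the radius for the behaviour at infinity, and constant for the
  oscillation, where the bound must stay affine in the mean of \<open>norm (dv y) powr p\<close> so
  that Fubini applies.\<close>

lemma cube_avg_deriv_bound:
  fixes dv :: "'a::euclidean_space \<Rightarrow> 'a"
  assumes dv: "continuous_on UNIV dv" and "s > 0" "1 < p"
  shows "norm (integral (cbox 0 One) (\<lambda>z. dv (x + R *\<^sub>R z) \<bullet> z))
    \<le> real DIM('a) * (s + s powr (1 - p) * cube_avg (\<lambda>y. norm (dv y) powr p) x R)"
proof -
  let ?q = "\<lambda>y. norm (dv y) powr p"
  have q: "continuous_on UNIV ?q"
    using \<open>1 < p\<close> by (intro continuous_on_powr' continuous_intros dv) auto
  have i: "(\<lambda>z. ?q (x + R *\<^sub>R z)) integrable_on cbox 0 One"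
    by (rule cube_integrable[OF q])
  have "norm (integral (cbox 0 One) (\<lambda>z. dv (x + R *\<^sub>R z) \<bullet> z))
    \<le> integral (cbox 0 One) (\<lambda>z. real DIM('a) * (s + s powr (1 - p) * ?q (x + R *\<^sub>R z)))"
  proof (rule integral_norm_bound_integral)
    show "(\<lambda>z. dv (x + R *\<^sub>R z) \<bullet> z) integrable_on cbox 0 One"
      by (intro integrable_continuous continuous_on_compose2[OF dv] continuous_intros) auto
    show "(\<lambda>z. real DIM('a) * (s + s powr (1 - p) * ?q (x + R *\<^sub>R z))) integrable_on cbox 0 One"
      by (intro integrable_continuous continuous_on_compose2[OF q] continuous_intros) auto
    fix z :: 'a assume z: "z \<in> cbox 0 One"
    have "norm (dv (x + R *\<^sub>R z) \<bullet> z) \<le> norm (dv (x + R *\<^sub>R z)) * norm z"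
      using Cauchy_Schwarz_ineq2 by auto
    also have "\<dots> \<le> norm (dv (x + R *\<^sub>R z)) * real DIM('a)"
      by (intro mult_left_mono norm_le_DIM_unit_cube z) auto
    also have "\<dots> \<le> (s + s powr (1 - p) * ?q (x + R *\<^sub>R z)) * real DIM('a)"
      using assms by (intro mult_right_mono le_add_powr) auto
    finally show "norm (dv (x + R *\<^sub>R z) \<bullet> z) \<le> real DIM('a) * (s + s powr (1 - p) * ?q (x + R *\<^sub>R z))"
      by (simp add: mult.commute)
  qed
  also have "\<dots> = real DIM('a) * (s + s powr (1 - p) * cube_avg ?q x R)"
    using integral_add[OF integrable_const integrable_on_cmult_left[OF i], of s "s powr (1 - p)"]
    by (simp add: cube_avg_def)
  finally show ?thesis .
qed

text \<open>The derivative bound is integrated from radius 0, where the average equals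
  \<open>v x\<close>. With the same \<open>s\<close> at all radii, \<open>x\<close> enters the
  result only through an integral whose own integral over \<open>x\<close> can be computed.\<close>

lemma cube_avg_osc:
  fixes v :: "'a::euclidean_space \<Rightarrow> real"
  assumes D: "\<And>x. (v has_derivative (\<lambda>h. dv x \<bullet> h)) (at x)" and dv: "continuous_on UNIV dv"
    and "s > 0" "1 < p" "R > 0"
  shows "\<bar>cube_avg v x R - v x\<bar>
    \<le> real DIM('a) * (s * R + s powr (1 - p) * integral {0..R} (cube_avg (\<lambda>y. norm (dv y) powr p) x))"
proof -
  let ?q = "\<lambda>y. norm (dv y) powr p"
  let ?\<phi> = "\<lambda>\<rho>. real DIM('a) * (s * \<rho> + s powr (1 - p) * integral {0..\<rho>} (cube_avg ?q x))"
  have q: "continuous_on UNIV ?q"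
    using \<open>1 < p\<close> by (intro continuous_on_powr' continuous_intros dv) auto
  have v: "continuous_on UNIV v"
    using D by (meson continuous_at_imp_continuous_on has_derivative_continuous)
  have d: "((\<lambda>\<rho>. integral {0..\<rho>} (cube_avg ?q x)) has_real_derivative cube_avg ?q x y) (at y within {0..R})"
    if "y \<in> {0..R}" for y
    using that by (intro integral_has_real_derivative continuous_on_cube_avg q)
  have "norm (cube_avg v x R - cube_avg v x 0) \<le> ?\<phi> R - ?\<phi> 0"
  proof (rule differentiable_bound_general[OF \<open>R > 0\<close>])
    have "?\<phi> differentiable_on {0..R}"
      unfolding differentiable_on_def
    proof
      fix y assume y: "y \<in> {0..R}"
      show "?\<phi> differentiable (at y within {0..R})"
        by (rule differentiableI[OF has_field_derivative_imp_has_derivative])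
          (auto intro!: derivative_eq_intros d[OF y])
    qed
    then show "continuous_on {0..R} ?\<phi>"
      by (rule differentiable_imp_continuous_on)
    show "continuous_on {0..R} (cube_avg v x)"
      by (rule continuous_on_cube_avg[OF v])
    fix y assume y: "0 < y" "y < R"
    show "(cube_avg v x has_vector_derivative integral (cbox 0 One) (\<lambda>z. dv (x + y *\<^sub>R z) \<bullet> z)) (at y)"
      by (rule cube_avg_deriv[OF D dv])
    have "((\<lambda>\<rho>. integral {0..\<rho>} (cube_avg ?q x)) has_real_derivative cube_avg ?q x y) (at y)"
      using d[of y] y by (simp add: at_within_Icc_at)
    then show "(?\<phi> has_vector_derivative real DIM('a) * (s + s powr (1 - p) * cube_avg ?q x y)) (at y)"
      unfolding has_real_derivative_iff_has_vector_derivative[symmetric]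
      by (auto intro!: derivative_eq_intros)
    show "norm (integral (cbox 0 One) (\<lambda>z. dv (x + y *\<^sub>R z) \<bullet> z)) \<le> real DIM('a) * (s + s powr (1 - p) * cube_avg ?q x y)"
      by (rule cube_avg_deriv_bound[OF dv \<open>s > 0\<close> \<open>1 < p\<close>])
  qed
  then show ?thesis by (simp add: cube_avg_0)
qed

text \<open>As \<open>v\<close> is integrable, its average tends to 0 for growing cubes, so the
  average is controlled by integrating the derivative bound over all larger radii; this converges
  because \<open>p\<close> is below the dimension. The bound \<open>V\<close> serves the limit at
  infinity and drops out of the estimate.\<close>

lemma cube_avg_decay:
  fixes v :: "'a::euclidean_space \<Rightarrow> real"
  assumes D: "\<And>x. (v has_derivative (\<lambda>h. dv x \<bullet> h)) (at x)" and dv: "continuous_on UNIV dv"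
    and p: "1 < p" "p < real DIM('a)" and "R > 0" and "K > 0"
    and K: "(\<integral>\<^sup>+y. ennreal (norm (dv y) powr p) \<partial>lborel) \<le> ennreal (K powr p)"
    and V: "(\<integral>\<^sup>+y. ennreal \<bar>v y\<bar> \<partial>lborel) \<le> ennreal V" "0 \<le> V"
  shows "\<bar>cube_avg v x R\<bar> \<le> 2 * real DIM('a) / (real DIM('a) / p - 1) * K * R powr (1 - real DIM('a) / p)"
proof -
  let ?N = "real DIM('a)"
  let ?q = "\<lambda>y. norm (dv y) powr p"
  define e where "e = ?N / p - 1"
  have e: "e > 0" using p by (simp add: e_def field_simps)
  define C where "C = 2 * ?N / e * K"
  have C: "C > 0" using e \<open>K > 0\<close> by (simp add: C_def)
  have q: "continuous_on UNIV ?q"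
    using \<open>1 < p\<close> by (intro continuous_on_powr' continuous_intros dv) auto
  have v: "continuous_on UNIV v"
    using D by (meson continuous_at_imp_continuous_on has_derivative_continuous)
  have step: "\<bar>cube_avg v x R\<bar> \<le> V * R' powr - ?N + C * R powr - e" if "R' > R" for R'
  proof -
    have "norm (cube_avg v x R' - cube_avg v x R) \<le> - C * R' powr - e - (- C * R powr - e)"
    proof (rule differentiable_bound_general[OF \<open>R' > R\<close>])
      show "continuous_on {R..R'} (\<lambda>\<rho>. - C * \<rho> powr - e)"
        using \<open>R > 0\<close> by (intro continuous_intros) auto
      show "continuous_on {R..R'} (cube_avg v x)"
        by (rule continuous_on_cube_avg[OF v])
      fix y assume y: "R < y" "y < R'"
      with \<open>R > 0\<close> have "y > 0" by linarith
      show "(cube_avg v x has_vector_derivative integral (cbox 0 One) (\<lambda>z. dv (x + y *\<^sub>R z) \<bullet> z)) (at y)"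
        by (rule cube_avg_deriv[OF D dv])
      show "((\<lambda>\<rho>. - C * \<rho> powr - e) has_vector_derivative C * e * y powr (- e - 1)) (at y)"
        unfolding has_real_derivative_iff_has_vector_derivative[symmetric]
        using \<open>y > 0\<close> by (auto intro!: derivative_eq_intros)
      \<comment> \<open>With N the dimension, the mean of \<open>norm (dv _) powr p\<close> over a
        cube of side \<open>y\<close> is at most \<open>K powr p * y powr - N\<close>, which is
        \<open>s powr p\<close>; this choice makes both terms of the derivative bound equal.\<close>
      define s where "s = K * y powr (- ?N / p)"
      have s: "s > 0" using \<open>K > 0\<close> \<open>y > 0\<close> by (simp add: s_def)
      have "norm (integral (cbox 0 One) (\<lambda>z. dv (x + y *\<^sub>R z) \<bullet> z))
        \<le> ?N * (s + s powr (1 - p) * cube_avg ?q x y)"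
        by (rule cube_avg_deriv_bound[OF dv s p(1)])
      also have "\<dots> \<le> ?N * (s + s powr (1 - p) * (y powr - ?N * K powr p))"
        by (intro mult_left_mono add_left_mono cube_avg_le_integral q K \<open>y > 0\<close>) auto
      also have "s powr (1 - p) * (y powr - ?N * K powr p) = s"
      proof -
        have "s powr (1 - p) = K powr (1 - p) * y powr (- ?N / p * (1 - p))"
          using \<open>K > 0\<close> \<open>y > 0\<close> by (simp add: s_def powr_mult powr_powr)
        then have "s powr (1 - p) * (y powr - ?N * K powr p)
          = (K powr (1 - p) * K powr p) * (y powr (- ?N / p * (1 - p)) * y powr - ?N)"
          by simp
        also have "\<dots> = K * y powr (- ?N / p * (1 - p) - ?N)"
          using \<open>K > 0\<close> by (simp add: powr_add[symmetric])
        also have "- ?N / p * (1 - p) - ?N = - ?N / p"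
          using p by (simp add: field_simps)
        finally show ?thesis by (simp add: s_def)
      qed
      also have "?N * (s + s) = C * e * y powr (- e - 1)"
      proof -
        have "C * e = 2 * ?N * K" using e by (simp add: C_def)
        moreover have "- e - 1 = - ?N / p" by (simp add: e_def)
        ultimately show ?thesis by (simp add: s_def)
      qed
      finally show "norm (integral (cbox 0 One) (\<lambda>z. dv (x + y *\<^sub>R z) \<bullet> z)) \<le> C * e * y powr (- e - 1)" .
    qed
    moreover have "C * R' powr - e \<ge> 0" using C by simp
    moreover have "\<bar>cube_avg v x R'\<bar> \<le> V * R' powr - ?N"
    proof -
      have "\<bar>cube_avg v x R'\<bar> \<le> cube_avg (\<lambda>y. \<bar>v y\<bar>) x R'"
        unfolding cube_avg_def real_norm_def[symmetric]
        by (intro integral_norm_bound_integral cube_integrable v continuous_intros) auto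
      also have "\<dots> \<le> R' powr - ?N * V"
        using \<open>R > 0\<close> \<open>R' > R\<close> by (intro cube_avg_le_integral continuous_intros v V) auto
      finally show ?thesis by (simp add: mult.commute)
    qed
    ultimately show ?thesis by simp
  qed
  have "((\<lambda>R'. V * R' powr - ?N + C * R powr - e) \<longlongrightarrow> V * 0 + C * R powr - e) at_top"
    by (intro tendsto_intros tendsto_neg_powr filterlim_ident) auto
  moreover have "eventually (\<lambda>R'. \<bar>cube_avg v x R\<bar> \<le> V * R' powr - ?N + C * R powr - e) at_top"
    using eventually_gt_at_top[of R] by eventually_elim (rule step)
  ultimately have "\<bar>cube_avg v x R\<bar> \<le> V * 0 + C * R powr - e"
    by (intro tendsto_lowerbound[of _ _ at_top]) auto
  then show ?thesis by (simp add: C_def e_def)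
qed

text \<open>Tonelli moves the integral over \<open>x\<close> inside, where translation invariance
  makes it independent of the radius and of the point of the cube; the interval then contributes
  \<open>R\<close> and the unit cube contributes 1.\<close>

lemma nn_integral_cube_avg_osc:
  fixes q :: "'a::euclidean_space \<Rightarrow> real"
  assumes q: "continuous_on UNIV q" "\<And>y. 0 \<le> q y" and "R \<ge> 0"
  shows "(\<integral>\<^sup>+x. ennreal (integral {0..R} (cube_avg q x)) \<partial>lborel) = ennreal R * (\<integral>\<^sup>+y. ennreal (q y) \<partial>lborel)"
    and "(\<lambda>x. ennreal (integral {0..R} (cube_avg q x))) \<in> borel_measurable lborel"
proof -
  have [measurable]: "q \<in> borel_measurable borel"
    using q(1) by (rule borel_measurable_continuous_onI)
  have [measurable]: "{0..R} \<in> sets borel" "cbox (0::'a) One \<in> sets borel" by auto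
  have eq: "ennreal (integral {0..R} (cube_avg q x))
    = (\<integral>\<^sup>+\<rho>. (\<integral>\<^sup>+z. ennreal (q (x + \<rho> *\<^sub>R z)) * indicator (cbox 0 One) z \<partial>lborel) * indicator {0..R} \<rho> \<partial>lborel)" for x
  proof -
    have "cube_avg q x integrable_on {0..R}"
      by (intro integrable_continuous_interval continuous_on_cube_avg q)
    then have "(\<integral>\<^sup>+\<rho>. ennreal (cube_avg q x \<rho>) * indicator {0..R} \<rho> \<partial>lborel) = ennreal (integral {0..R} (cube_avg q x))"
      by (intro nn_integral_has_integral_lebesgue' cube_avg_nonneg q integrable_integral)
    then show ?thesis by (simp add: cube_avg_eq_nn_integral[OF q])
  qed
  show "(\<lambda>x. ennreal (integral {0..R} (cube_avg q x))) \<in> borel_measurable lborel"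
    unfolding eq by measurable
  have "(\<integral>\<^sup>+x. ennreal (integral {0..R} (cube_avg q x)) \<partial>lborel)
    = (\<integral>\<^sup>+\<rho>. (\<integral>\<^sup>+x. (\<integral>\<^sup>+z. ennreal (q (x + \<rho> *\<^sub>R z)) * indicator (cbox 0 One) z \<partial>lborel) * indicator {0..R} \<rho> \<partial>lborel) \<partial>lborel)"
    unfolding eq by (rule lborel_pair.Fubini') measurable
  also have "\<dots> = (\<integral>\<^sup>+\<rho>. (\<integral>\<^sup>+y. ennreal (q y) \<partial>lborel) * indicator {0..R} (\<rho>::real) \<partial>lborel)"
  proof (rule nn_integral_cong)
    fix \<rho> :: real
    have "(\<integral>\<^sup>+x. (\<integral>\<^sup>+z. ennreal (q (x + \<rho> *\<^sub>R z)) * indicator (cbox 0 One) z \<partial>lborel) \<partial>lborel)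
      = (\<integral>\<^sup>+z. (\<integral>\<^sup>+x. ennreal (q (x + \<rho> *\<^sub>R z)) * indicator (cbox 0 One) z \<partial>lborel) \<partial>lborel)"
      by (rule lborel_pair.Fubini') measurable
    also have "\<dots> = (\<integral>\<^sup>+z. (\<integral>\<^sup>+y. ennreal (q y) \<partial>lborel) * indicator (cbox (0::'a) One) z \<partial>lborel)"
    proof (rule nn_integral_cong)
      fix z :: 'a
      have "(\<integral>\<^sup>+x. ennreal (q (\<rho> *\<^sub>R z + 1 *\<^sub>R x)) \<partial>lborel) = (\<integral>\<^sup>+y. ennreal (q y) \<partial>lborel)"
        by (subst nn_integral_lborel_shift_scale) auto
      then show "(\<integral>\<^sup>+x. ennreal (q (x + \<rho> *\<^sub>R z)) * indicator (cbox 0 One) z \<partial>lborel)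
        = (\<integral>\<^sup>+y. ennreal (q y) \<partial>lborel) * indicator (cbox 0 One) z"
        by (simp add: nn_integral_multc add.commute)
    qed
    also have "\<dots> = (\<integral>\<^sup>+y. ennreal (q y) \<partial>lborel)"
      by (simp add: nn_integral_cmult emeasure_eq_ennreal_measure[OF emeasure_lborel_cbox_finite[THEN less_imp_neq, simplified]])
    finally show "(\<integral>\<^sup>+x. (\<integral>\<^sup>+z. ennreal (q (x + \<rho> *\<^sub>R z)) * indicator (cbox 0 One) z \<partial>lborel) * indicator {0..R} \<rho> \<partial>lborel)
       = (\<integral>\<^sup>+y. ennreal (q y) \<partial>lborel) * indicator {0..R} \<rho>"
      by (simp add: nn_integral_multc)
  qed
  also have "\<dots> = ennreal R * (\<integral>\<^sup>+y. ennreal (q y) \<partial>lborel)"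
    using \<open>R \<ge> 0\<close> by (subst nn_integral_cmult) (auto simp: mult.commute)
  finally show "(\<integral>\<^sup>+x. ennreal (integral {0..R} (cube_avg q x)) \<partial>lborel) = ennreal R * (\<integral>\<^sup>+y. ennreal (q y) \<partial>lborel)" .
qed

text \<open>Where \<open>v\<close> exceeds \<open>t\<close> in modulus, the average over the cube of
  side \<open>R\<close> and the constant part of the oscillation account for at most half of
  \<open>t\<close>, so the integral part of the oscillation must be large, and Markov's inequality
  bounds the set. The exponent \<open>p * N / (N - p)\<close> is the Sobolev conjugate of
  \<open>p\<close>.\<close>

lemma weak_sobolev_C1:
  fixes v :: "'a::euclidean_space \<Rightarrow> real"
  assumes D: "\<And>x. (v has_derivative (\<lambda>h. dv x \<bullet> h)) (at x)" and dv: "continuous_on UNIV dv"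
    and p: "1 < p" "p < real DIM('a)" and "K > 0" "t > 0"
    and K: "(\<integral>\<^sup>+y. ennreal (norm (dv y) powr p) \<partial>lborel) \<le> ennreal (K powr p)"
    and V: "(\<integral>\<^sup>+y. ennreal \<bar>v y\<bar> \<partial>lborel) < \<infinity>"
  defines "N \<equiv> real DIM('a)"
  defines "C \<equiv> 8 * N / (N / p - 1)"
  shows "emeasure lborel {x. \<bar>v x\<bar> > t} \<le> ennreal ((4 * N) powr p * C powr (p * p / (N - p)) * (K / t) powr (p * N / (N - p)))"
proof -
  let ?q = "\<lambda>y. norm (dv y) powr p"
  have N: "N > 1" "N - p > 0" using p by (auto simp: N_def)
  have C: "C > 0" using N p by (simp add: C_def field_simps)
  \<comment> \<open>Each of the two harmless terms receives a quarter of \<open>t\<close>: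
    \<open>R\<close> makes the decay bound equal to \<open>t / 4\<close>, as \<open>C\<close> is
    four times its constant, and \<open>s\<close> below makes \<open>N * s * R\<close> equal to
    \<open>t / 4\<close>. The rest forces \<open>P x\<close> to be at least the threshold
    \<open>c\<close>.\<close>
  define R where "R = (C * (K / t)) powr (p / (N - p))"
  have R: "R > 0" using C \<open>K > 0\<close> \<open>t > 0\<close> by (simp add: R_def)
  define s where "s = t / (4 * N * R)"
  have s: "s > 0" using R N \<open>t > 0\<close> by (simp add: s_def)
  define P where "P x = integral {0..R} (cube_avg ?q x)" for x
  have q: "continuous_on UNIV ?q" "\<And>y. 0 \<le> ?q y"
    subgoal using p by (intro continuous_on_powr' continuous_intros dv) auto
    subgoal by simp
    done
  have v: "continuous_on UNIV v"
    using D by (meson continuous_at_imp_continuous_on has_derivative_continuous)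
  have [measurable]: "v \<in> borel_measurable borel"
    using v by (rule borel_measurable_continuous_onI)
  note PI = nn_integral_cube_avg_osc[OF q less_imp_le[OF R], folded P_def]
  have P0: "0 \<le> P x" for x
    unfolding P_def
    by (intro integral_nonneg integrable_continuous_interval continuous_on_cube_avg cube_avg_nonneg q)
  define c where "c = t / (2 * N * s powr (1 - p))"
  have c: "c > 0" using N s \<open>t > 0\<close> by (simp add: c_def)
  have far: "\<bar>cube_avg v x R\<bar> \<le> t / 4" for x
  proof -
    have "\<bar>cube_avg v x R\<bar> \<le> 2 * N / (N / p - 1) * K * R powr (1 - N / p)"
      unfolding N_def using V by (intro cube_avg_decay[OF D dv p R \<open>K > 0\<close> K, where V = "enn2real (\<integral>\<^sup>+y. ennreal \<bar>v y\<bar> \<partial>lborel)"]) auto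
    also have "R powr (1 - N / p) = (C * (K / t)) powr (-1)"
      unfolding R_def powr_powr using p N by (intro arg_cong2[where f="(powr)"]) (auto simp: field_simps)
    also have "\<dots> = t / (C * K)"
      using C \<open>K > 0\<close> \<open>t > 0\<close> by (simp add: powr_minus_divide)
    also have "2 * N / (N / p - 1) * K * (t / (C * K)) = t / 4"
    proof -
      define e where "e = N / p - 1"
      have "e > 0" using N p by (simp add: e_def field_simps)
      then show ?thesis
        using \<open>K > 0\<close> N unfolding C_def e_def[symmetric] by simp
    qed
    finally show ?thesis .
  qed
  have sub: "1 \<le> ennreal (1 / c) * ennreal (P x)" if "\<bar>v x\<bar> > t" for x
  proof -
    have "\<bar>cube_avg v x R - v x\<bar> \<le> N * (s * R + s powr (1 - p) * P x)"
      unfolding N_def P_def by (rule cube_avg_osc[OF D dv s p(1) R])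
    moreover have "N * (s * R) = t / 4" using N R by (simp add: s_def)
    ultimately have "t / 2 \<le> N * s powr (1 - p) * P x"
      using far[of x] that by (simp add: algebra_simps)
    then have "c \<le> P x" using N s by (simp add: c_def field_simps)
    then have "ennreal 1 \<le> ennreal (1 / c * P x)"
      using c by (intro ennreal_leI) (simp add: field_simps)
    also have "\<dots> = ennreal (1 / c) * ennreal (P x)"
      using c P0[of x] by (intro ennreal_mult) auto
    finally show ?thesis by simp
  qed
  have "emeasure lborel {x. \<bar>v x\<bar> > t} = (\<integral>\<^sup>+x. indicator {x. \<bar>v x\<bar> > t} x \<partial>lborel)"
    by simp
  also have "\<dots> \<le> (\<integral>\<^sup>+x. ennreal (1 / c) * ennreal (P x) \<partial>lborel)"
    using sub by (intro nn_integral_mono) (auto simp: indicator_def)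
  also have "\<dots> = ennreal (1 / c) * (ennreal R * (\<integral>\<^sup>+y. ennreal (?q y) \<partial>lborel))"
    using PI by (simp add: nn_integral_cmult)
  also have "\<dots> \<le> ennreal (1 / c) * (ennreal R * ennreal (K powr p))"
    by (intro mult_left_mono K) auto
  also have "\<dots> = ennreal (1 / c * (R * K powr p))"
  proof -
    have "ennreal (1 / c * (R * K powr p)) = ennreal (1 / c) * ennreal (R * K powr p)"
      using c R by (intro ennreal_mult) auto
    also have "ennreal (R * K powr p) = ennreal R * ennreal (K powr p)"
      using R by (intro ennreal_mult) auto
    finally show ?thesis by simp
  qed
  also have "\<dots> \<le> ennreal ((4 * N) powr p * C powr (p * p / (N - p)) * (K / t) powr (p * N / (N - p)))"
  proof (rule ennreal_leI)
    have "1 / c * (R * K powr p) = (1 / 2) * ((4 * N * R / t) * s powr (1 - p)) * K powr p"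
      using N \<open>t > 0\<close> s by (simp add: c_def field_simps)
    also have "4 * N * R / t = s powr (- 1)"
      using N R \<open>t > 0\<close> by (simp add: s_def powr_minus_divide)
    also have "s powr (-1) * s powr (1 - p) = s powr (- p)"
      using powr_add[of s "-1" "1 - p"] by simp
    also have "s powr (- p) = (4 * N) powr p * R powr p / t powr p"
      using N R \<open>t > 0\<close> by (simp add: s_def powr_minus powr_divide powr_mult)
    also have "1 / 2 * ((4 * N) powr p * R powr p / t powr p) * K powr p = 1 / 2 * ((4 * N) powr p * (R powr p * (K / t) powr p))"
      using \<open>K > 0\<close> \<open>t > 0\<close> by (simp add: powr_divide)
    also have "R powr p = C powr (p * p / (N - p)) * (K / t) powr (p * p / (N - p))"
      unfolding R_def using C \<open>K > 0\<close> \<open>t > 0\<close> by (simp add: powr_powr powr_mult powr_divide)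
    also have "C powr (p * p / (N - p)) * (K / t) powr (p * p / (N - p)) * (K / t) powr p
       = C powr (p * p / (N - p)) * (K / t) powr (p * p / (N - p) + p)"
      by (simp add: powr_add)
    also have "p * p / (N - p) + p = p * N / (N - p)" using N by (simp add: field_simps)
    finally have "1 / c * (R * K powr p) = 1 / 2 * ((4 * N) powr p * (C powr (p * p / (N - p)) * (K / t) powr (p * N / (N - p))))" .
    then have "1 / c * (R * K powr p) = 1 / 2 * ((4 * N) powr p * C powr (p * p / (N - p)) * (K / t) powr (p * N / (N - p)))"
      by (simp only: mult.assoc)
    moreover have "0 \<le> (4 * N) powr p * C powr (p * p / (N - p)) * (K / t) powr (p * N / (N - p))" by simp
    ultimately show "1 / c * (R * K powr p) \<le> (4 * N) powr p * C powr (p * p / (N - p)) * (K / t) powr (p * N / (N - p))"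
      by linarith
  qed
  finally show ?thesis .
qed


section \<open>From smooth functions to \<open>W01p0\<close> by approximation\<close>

lemma abs_powr_diff_le:
  fixes a b :: "'b::real_normed_vector"
  assumes "1 < p"
  shows "norm (a - b) powr p \<le> 2 powr p * (norm a powr p + norm b powr p)"
proof -
  have "norm (a - b) \<le> 2 * max (norm a) (norm b)"
    using norm_triangle_ineq4[of a b] by linarith
  then have "norm (a - b) powr p \<le> (2 * max (norm a) (norm b)) powr p"
    using assms by (intro powr_mono2) auto
  also have "\<dots> = 2 powr p * max (norm a) (norm b) powr p"
    by (simp add: powr_mult)
  also have "\<dots> \<le> 2 powr p * (norm a powr p + norm b powr p)"
    by (intro mult_left_mono) (auto simp: max_def)
  finally show ?thesis .
qed

lemma Lp_fun_diff:
  assumes "1 < p" "Lp_fun M p f" "Lp_fun M p g"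
  shows "Lp_fun M p (\<lambda>x. f x - g x)"
  unfolding Lp_fun_def
proof
  have [measurable]: "f \<in> borel_measurable M" "g \<in> borel_measurable M"
    using assms by (auto simp: Lp_fun_def)
  show "(\<lambda>x. f x - g x) \<in> borel_measurable M" by measurable
  show "integrable M (\<lambda>x. norm (f x - g x) powr p)"
  proof (rule Bochner_Integration.integrable_bound)
    show "integrable M (\<lambda>x. 2 powr p * (norm (f x) powr p + norm (g x) powr p))"
      using assms by (auto simp: Lp_fun_def)
  qed (use abs_powr_diff_le[OF assms(1)] in \<open>auto intro!: AE_I2\<close>)
qed

lemma integral_powr_diff_le:
  assumes "1 < p" "Lp_fun M p f" "Lp_fun M p g"
  shows "(\<integral>x. norm (f x - g x) powr p \<partial>M)
    \<le> 2 powr p * ((\<integral>x. norm (f x) powr p \<partial>M) + (\<integral>x. norm (g x) powr p \<partial>M))"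
proof -
  have i: "integrable M (\<lambda>x. norm (f x) powr p)" "integrable M (\<lambda>x. norm (g x) powr p)"
    using assms by (auto simp: Lp_fun_def)
  have "(\<integral>x. norm (f x - g x) powr p \<partial>M) \<le> (\<integral>x. 2 powr p * (norm (f x) powr p + norm (g x) powr p) \<partial>M)"
    using Lp_fun_diff[OF assms] i abs_powr_diff_le[OF assms(1)]
    by (intro integral_mono) (auto simp: Lp_fun_def)
  also have "\<dots> = 2 powr p * ((\<integral>x. norm (f x) powr p \<partial>M) + (\<integral>x. norm (g x) powr p \<partial>M))"
    using i by simp
  finally show ?thesis .
qed

lemma integral_powr_diff_tendsto_0:
  assumes "1 < p" "\<And>n::nat. Lp_fun M p (f n)" "\<And>n. Lp_fun M p (g n)"
    and "(\<lambda>n. \<integral>x. norm (f n x) powr p \<partial>M) \<longlonglongrightarrow> 0" "(\<lambda>n. \<integral>x. norm (g n x) powr p \<partial>M) \<longlonglongrightarrow> 0"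
  shows "(\<lambda>n. \<integral>x. norm (f n x - g n x) powr p \<partial>M) \<longlonglongrightarrow> 0"
proof (rule tendsto_sandwich)
  show "eventually (\<lambda>n. 0 \<le> (\<integral>x. norm (f n x - g n x) powr p \<partial>M)) sequentially" by simp
  show "eventually (\<lambda>n. (\<integral>x. norm (f n x - g n x) powr p \<partial>M)
    \<le> 2 powr p * ((\<integral>x. norm (f n x) powr p \<partial>M) + (\<integral>x. norm (g n x) powr p \<partial>M))) sequentially"
    using integral_powr_diff_le[OF assms(1-3)] by simp
  have "(\<lambda>n. 2 powr p * ((\<integral>x. norm (f n x) powr p \<partial>M) + (\<integral>x. norm (g n x) powr p \<partial>M)))
    \<longlonglongrightarrow> 2 powr p * (0 + 0)"
    by (intro tendsto_intros assms)
  then show "(\<lambda>n. 2 powr p * ((\<integral>x. norm (f n x) powr p \<partial>M) + (\<integral>x. norm (g n x) powr p \<partial>M)))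
    \<longlonglongrightarrow> 0" by simp
qed simp

text \<open>\<open>Ck_fun\<close> only yields some gradient with continuous components; uniqueness
  of derivatives identifies it with \<open>d\<phi>\<close>. Off the closed support,
  \<open>\<phi>\<close> vanishes on a whole neighbourhood, hence so does the gradient.\<close>

lemma test_fun_C1:
  fixes \<phi> :: "'a::euclidean_space \<Rightarrow> real"
  assumes "test_fun \<Omega> \<phi>" "is_grad \<phi> d\<phi>"
  shows "continuous_on UNIV d\<phi>"
    and "compact (closure {x. \<phi> x \<noteq> 0})" "closure {x. \<phi> x \<noteq> 0} \<subseteq> \<Omega>"
    and "x \<notin> closure {x. \<phi> x \<noteq> 0} \<Longrightarrow> d\<phi> x = 0"
proof -
  show "compact (closure {x. \<phi> x \<noteq> 0})" "closure {x. \<phi> x \<noteq> 0} \<subseteq> \<Omega>"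
    using assms by (auto simp: test_fun_def)
  have d: "(\<phi> has_derivative (\<lambda>h. d\<phi> x \<bullet> h)) (at x)" for x
    using assms by (auto simp: is_grad_def)
  have "Ck_fun (Suc 0) \<phi>" using assms by (auto simp: test_fun_def smooth_fun_def)
  then obtain g where g: "\<And>x. (\<phi> has_derivative (\<lambda>h. g x \<bullet> h)) (at x)"
    and c: "\<And>i. i \<in> Basis \<Longrightarrow> continuous_on UNIV (\<lambda>x. g x \<bullet> i)"
    by auto
  have "d\<phi> x = g x" for x
    using has_derivative_unique[OF d[of x] g[of x]] by (metis vector_eq_rdot)
  then have "d\<phi> = g" by auto
  moreover have "continuous_on UNIV g"
    using c by (simp add: continuous_on_componentwise[of UNIV g])
  ultimately show "continuous_on UNIV d\<phi>" by simp
  assume x: "x \<notin> closure {x. \<phi> x \<noteq> 0}"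
  have "(\<phi> has_derivative (\<lambda>h. 0)) (at x)"
  proof (rule has_derivative_transform_within_open[OF has_derivative_const])
    show "open (- closure {x. \<phi> x \<noteq> 0})" "x \<in> - closure {x. \<phi> x \<noteq> 0}" using x by auto
    fix y assume "y \<in> - closure {x. \<phi> x \<noteq> 0}"
    then show "0 = \<phi> y" using closure_subset[of "{x. \<phi> x \<noteq> 0}"] by auto
  qed
  from has_derivative_unique[OF d[of x] this] show "d\<phi> x = 0"
    by (metis inner_eq_zero_iff)
qed

text \<open>A bridge between two measures: the estimate for C^1 functions lives on the whole space
  with \<open>lborel\<close>, the Sobolev space on \<open>\<Omega>\<close> with restricted Lebesgue
  measure. Vanishing off a compact subset of \<open>\<Omega>\<close> makes the integrals
  agree.\<close>

lemma compact_support_integrals: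
  fixes g :: "'a::euclidean_space \<Rightarrow> real"
  assumes g: "continuous_on UNIV g" "\<And>y. 0 \<le> g y" and K: "compact K" "K \<subseteq> \<Omega>"
    and z: "\<And>x. x \<notin> K \<Longrightarrow> g x = 0" and \<Omega>: "open \<Omega>"
  shows "integrable (lebesgue_on \<Omega>) g"
    and "(\<integral>\<^sup>+x. ennreal (g x) \<partial>lborel) = ennreal (integral\<^sup>L (lebesgue_on \<Omega>) g)"
proof -
  have [measurable]: "g \<in> borel_measurable borel"
    using g(1) by (rule borel_measurable_continuous_onI)
  have S: "\<Omega> \<inter> space lebesgue \<in> sets lebesgue" using \<Omega> by auto
  have "integrable lborel (\<lambda>x. indicator K x *\<^sub>R g x)"
    using borel_integrable_compact[OF K(1) continuous_on_subset[OF g(1)]] by simp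
  also have "(\<lambda>x. indicator K x *\<^sub>R g x) = g"
  proof
    show "indicator K x *\<^sub>R g x = g x" for x using z[of x] by (cases "x \<in> K") auto
  qed
  finally have i: "integrable lborel g" .
  have "integrable lebesgue (\<lambda>x. indicator \<Omega> x *\<^sub>R g x) = integrable lebesgue g"
    using z K by (intro Bochner_Integration.integrable_cong) (auto simp: indicator_def)
  then show i': "integrable (lebesgue_on \<Omega>) g"
    using i by (simp add: integrable_restrict_space[OF S] integrable_completion)
  have "(\<integral>\<^sup>+x. ennreal (g x) \<partial>lborel) = (\<integral>\<^sup>+x. ennreal (g x) \<partial>lebesgue)"
    by (simp add: nn_integral_completion)
  also have "\<dots> = (\<integral>\<^sup>+x. ennreal (g x) * indicator \<Omega> x \<partial>lebesgue)"
  proof (rule nn_integral_cong)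
    show "ennreal (g x) = ennreal (g x) * indicator \<Omega> x" for x
      using z[of x] K by (cases "x \<in> K") auto
  qed
  also have "\<dots> = (\<integral>\<^sup>+x. ennreal (g x) \<partial>lebesgue_on \<Omega>)"
    by (rule nn_integral_restrict_space[OF S, symmetric])
  also have "\<dots> = ennreal (integral\<^sup>L (lebesgue_on \<Omega>) g)"
    by (rule nn_integral_eq_integral[OF i']) (use g in auto)
  finally show "(\<integral>\<^sup>+x. ennreal (g x) \<partial>lborel) = ennreal (integral\<^sup>L (lebesgue_on \<Omega>) g)" .
qed

lemma test_fun_Lp:
  fixes \<phi> :: "'a::euclidean_space \<Rightarrow> real"
  assumes t: "test_fun \<Omega> \<phi>" "is_grad \<phi> d\<phi>" and \<Omega>: "open \<Omega>" and p: "1 < p"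
  shows "Lp_fun (lebesgue_on \<Omega>) p \<phi>" "Lp_fun (lebesgue_on \<Omega>) p d\<phi>"
proof -
  note c = test_fun_C1[OF t]
  have d: "(\<phi> has_derivative (\<lambda>h. d\<phi> x \<bullet> h)) (at x)" for x
    using t by (auto simp: is_grad_def)
  have v: "continuous_on UNIV \<phi>"
    using d by (meson continuous_at_imp_continuous_on has_derivative_continuous)
  have z: "\<phi> x = 0" if "x \<notin> closure {x. \<phi> x \<noteq> 0}" for x
    using that closure_subset[of "{x. \<phi> x \<noteq> 0}"] by auto
  have m: "g \<in> borel_measurable (lebesgue_on \<Omega>)" if "continuous_on UNIV g" for g :: "'a \<Rightarrow> 'c::euclidean_space"
    using that \<Omega> by (intro continuous_imp_measurable_on_sets_lebesgue) (auto intro: continuous_on_subset)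
  have "continuous_on UNIV (\<lambda>x. norm (\<phi> x) powr p)"
    using p by (intro continuous_on_powr' continuous_intros v) auto
  from compact_support_integrals(1)[OF this _ c(2,3) _ \<Omega>]
  show "Lp_fun (lebesgue_on \<Omega>) p \<phi>" unfolding Lp_fun_def
    using m[OF v] z by (metis norm_zero powr_ge_zero powr_0)
  have "continuous_on UNIV (\<lambda>x. norm (d\<phi> x) powr p)"
    using p by (intro continuous_on_powr' continuous_intros c(1)) auto
  from compact_support_integrals(1)[OF this _ c(2,3) _ \<Omega>]
  show "Lp_fun (lebesgue_on \<Omega>) p d\<phi>" unfolding Lp_fun_def
    using m[OF c(1)] c(4) by (metis norm_zero powr_ge_zero powr_0)
qed

text \<open>The constant is obtained before the domain and the functions, so it depends only on
  \<open>p\<close> and the dimension. Stating the estimate for a pair makes differences of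
  truncations admissible directly. The set is taken at \<open>2 * t\<close> because half of the
  height is spent on approximation.\<close>

lemma weak_sobolev_W01p0:
  fixes \<Omega> :: "'a::euclidean_space set"
  assumes p: "1 < p" "p < real DIM('a)"
  obtains S where "S > 0"
    "\<And>\<Omega> w1 w2 g1 g2 t. open \<Omega> \<Longrightarrow> bounded \<Omega> \<Longrightarrow> W01p0 \<Omega> p w1 g1 \<Longrightarrow> W01p0 \<Omega> p w2 g2 \<Longrightarrow> t > 0 \<Longrightarrow>
      t powr p * measure (lebesgue_on \<Omega>) {x \<in> \<Omega>. 2 * t \<le> \<bar>w1 x - w2 x\<bar>} powr ((real DIM('a) - p) / real DIM('a))
        \<le> S * (\<integral>x. norm (g1 x - g2 x :: 'a) powr p \<partial>lebesgue_on \<Omega>)"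
proof -
  define N where "N = real DIM('a)"
  have N: "N > 1" "N - p > 0" using p by (auto simp: N_def)
  define C where "C = 8 * N / (N / p - 1)"
  have C: "C > 0" using N p by (simp add: C_def field_simps)
  define D where "D = (4 * N) powr p * C powr (p * p / (N - p))"
  have D: "D > 0" using C N by (simp add: D_def)
  define S where "S = D powr ((N - p) / N) * 2 powr p"
  show ?thesis
  proof (rule that)
    show "S > 0" using D by (simp add: S_def)
    fix \<Omega> :: "'a set" and w1 w2 :: "'a \<Rightarrow> real" and g1 g2 :: "'a \<Rightarrow> 'a" and t :: real
    assume \<Omega>: "open \<Omega>" "bounded \<Omega>" and W: "W01p0 \<Omega> p w1 g1" "W01p0 \<Omega> p w2 g2" and t: "t > 0"
    let ?M = "lebesgue_on \<Omega>"
    have \<Omega>M: "\<Omega> \<in> sets lebesgue" using \<Omega> by auto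
    interpret finite_measure ?M
      by (rule finite_measure_lebesgue_on[OF bounded_set_imp_lmeasurable[OF \<Omega>(2) \<Omega>M]])
    have sp: "space ?M = \<Omega>" by simp
    define w where "w x = w1 x - w2 x" for x
    define g where "g x = g1 x - g2 x" for x
    define I where "I = (\<integral>x. norm (g x) powr p \<partial>?M)"
    define E where "E = {x \<in> \<Omega>. 2 * t \<le> \<bar>w x\<bar>}"
    have L: "Lp_fun ?M p w1" "Lp_fun ?M p g1" "Lp_fun ?M p w2" "Lp_fun ?M p g2"
      using W by (auto simp: W01p0_def)
    have w: "Lp_fun ?M p w" and g: "Lp_fun ?M p g"
      unfolding w_def g_def by (intro Lp_fun_diff p L)+
    have [measurable]: "w \<in> borel_measurable ?M" using w by (simp add: Lp_fun_def)
    have I0: "I \<ge> 0" by (simp add: I_def)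
    obtain \<phi>1 d\<phi>1 where a: "\<And>n::nat. test_fun \<Omega> (\<phi>1 n)" "\<And>n. is_grad (\<phi>1 n) (d\<phi>1 n)"
      "(\<lambda>n. \<integral>x. \<bar>\<phi>1 n x - w1 x\<bar> powr p \<partial>?M) \<longlonglongrightarrow> 0"
      "(\<lambda>n. \<integral>x. norm (d\<phi>1 n x - g1 x) powr p \<partial>?M) \<longlonglongrightarrow> 0"
      using W(1) by (auto simp: W01p0_def)
    obtain \<phi>2 d\<phi>2 where b: "\<And>n::nat. test_fun \<Omega> (\<phi>2 n)" "\<And>n. is_grad (\<phi>2 n) (d\<phi>2 n)"
      "(\<lambda>n. \<integral>x. \<bar>\<phi>2 n x - w2 x\<bar> powr p \<partial>?M) \<longlonglongrightarrow> 0"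
      "(\<lambda>n. \<integral>x. norm (d\<phi>2 n x - g2 x) powr p \<partial>?M) \<longlonglongrightarrow> 0"
      using W(2) by (auto simp: W01p0_def)
    note la = test_fun_Lp[OF a(1) a(2) \<Omega>(1) p(1)] and lb = test_fun_Lp[OF b(1) b(2) \<Omega>(1) p(1)]
    define \<phi> where "\<phi> n x = \<phi>1 n x - \<phi>2 n x" for n x
    define d\<phi> where "d\<phi> n x = d\<phi>1 n x - d\<phi>2 n x" for n x
    have l\<phi>: "Lp_fun ?M p (\<phi> n)" "Lp_fun ?M p (d\<phi> n)" for n
      unfolding \<phi>_def d\<phi>_def by (intro Lp_fun_diff p la lb)+
    have conv: "(\<lambda>n. \<integral>x. norm (\<phi> n x - w x) powr p \<partial>?M) \<longlonglongrightarrow> 0"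
    proof -
      have "(\<lambda>n. \<integral>x. norm ((\<phi>1 n x - w1 x) - (\<phi>2 n x - w2 x)) powr p \<partial>?M) \<longlonglongrightarrow> 0"
        by (rule integral_powr_diff_tendsto_0[OF p(1)]) (use a(3) b(3) in \<open>auto intro!: Lp_fun_diff p la lb L\<close>)
      then show ?thesis by (simp add: \<phi>_def w_def algebra_simps)
    qed
    have convd: "(\<lambda>n. \<integral>x. norm (d\<phi> n x - g x) powr p \<partial>?M) \<longlonglongrightarrow> 0"
    proof -
      have "(\<lambda>n. \<integral>x. norm ((d\<phi>1 n x - g1 x) - (d\<phi>2 n x - g2 x)) powr p \<partial>?M) \<longlonglongrightarrow> 0"
        by (rule integral_powr_diff_tendsto_0[OF p(1)]) (use a(4) b(4) in \<open>auto intro!: Lp_fun_diff p la lb L\<close>)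
      then show ?thesis by (simp add: d\<phi>_def g_def algebra_simps)
    qed
    \<comment> \<open>The gap \<open>J - I\<close> leaves room for the gradient error of the
      approximants and keeps \<open>K\<close> positive even if \<open>I = 0\<close>;
      \<open>J\<close> tends to \<open>I\<close> at the end. The factor in
      \<open>K powr p = 2 powr p * J\<close> comes from \<open>abs_powr_diff_le\<close>.\<close>
    have main: "t powr p * measure ?M E powr ((N - p) / N) \<le> S * J" if J: "J > I" for J
    proof -
      have J0: "J > 0" using J I0 by linarith
      define K where "K = 2 * J powr (1 / p)"
      have K: "K > 0" using J0 by (simp add: K_def)
      have Kp: "K powr p = 2 powr p * J" using J0 p by (simp add: K_def powr_mult powr_powr)
      define c where "c = D * (K / t) powr (p * N / (N - p))"
      have c: "c \<ge> 0" using D by (simp add: c_def)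
      have far: "measure ?M {x \<in> \<Omega>. t < \<bar>\<phi> n x\<bar>} \<le> c"
        if "(\<integral>x. norm (d\<phi> n x - g x) powr p \<partial>?M) < J - I" for n
      proof -
        let ?K = "closure {x. \<phi>1 n x \<noteq> 0} \<union> closure {x. \<phi>2 n x \<noteq> 0}"
        have z1: "\<phi> n x = 0" if "x \<notin> ?K" for x
        proof -
          have "x \<notin> {x. \<phi>1 n x \<noteq> 0}" "x \<notin> {x. \<phi>2 n x \<noteq> 0}"
            using subsetD[OF closure_subset[of "{x. \<phi>1 n x \<noteq> 0}"], of x]
              subsetD[OF closure_subset[of "{x. \<phi>2 n x \<noteq> 0}"], of x] that
            by (simp_all only: Un_iff) blast+
          then show ?thesis by (simp add: \<phi>_def)
        qed
        have z2: "d\<phi> n x = 0" if "x \<notin> ?K" for x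
          using that test_fun_C1(4)[OF a(1) a(2), of x n] test_fun_C1(4)[OF b(1) b(2), of x n]
          by (auto simp: d\<phi>_def)
        have Kc: "compact ?K" "?K \<subseteq> \<Omega>"
          using test_fun_C1(2,3)[OF a(1) a(2), of n] test_fun_C1(2,3)[OF b(1) b(2), of n] by auto
        have D1: "(\<phi>1 n has_derivative (\<lambda>h. d\<phi>1 n x \<bullet> h)) (at x)"
                 "(\<phi>2 n has_derivative (\<lambda>h. d\<phi>2 n x \<bullet> h)) (at x)" for x
          using a(2)[of n] b(2)[of n] by (auto simp: is_grad_def)
        have D: "(\<phi> n has_derivative (\<lambda>h. d\<phi> n x \<bullet> h)) (at x)" for x
          unfolding \<phi>_def[abs_def] d\<phi>_def
          by (auto intro!: derivative_eq_intros D1 simp: inner_diff_left)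
        have cd: "continuous_on UNIV (d\<phi> n)"
          unfolding d\<phi>_def[abs_def]
          by (intro continuous_intros test_fun_C1(1)[OF a(1) a(2)] test_fun_C1(1)[OF b(1) b(2)])
        have c\<phi>: "continuous_on UNIV (\<phi> n)"
          using D by (meson continuous_at_imp_continuous_on has_derivative_continuous)
        have [measurable]: "\<phi> n \<in> borel_measurable borel"
          using c\<phi> by (rule borel_measurable_continuous_onI)
        have "(\<integral>\<^sup>+x. ennreal (norm (d\<phi> n x) powr p) \<partial>lborel) = ennreal (\<integral>x. norm (d\<phi> n x) powr p \<partial>?M)"
          using p z2 by (intro compact_support_integrals(2)[OF _ _ Kc _ \<Omega>(1)] continuous_on_powr' continuous_intros cd) auto
        also have "\<dots> \<le> ennreal (K powr p)"
        proof (rule ennreal_leI)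
          have "(\<integral>x. norm (d\<phi> n x) powr p \<partial>?M) = (\<integral>x. norm ((d\<phi> n x - g x) - (0 - g x)) powr p \<partial>?M)"
            by simp
          also have "\<dots> \<le> 2 powr p * ((\<integral>x. norm (d\<phi> n x - g x) powr p \<partial>?M) + (\<integral>x. norm (0 - g x) powr p \<partial>?M))"
            by (intro integral_powr_diff_le p Lp_fun_diff l\<phi> g) (auto simp: Lp_fun_def)
          also have "\<dots> \<le> 2 powr p * J"
            using that by (intro mult_left_mono) (auto simp: I_def)
          finally show "(\<integral>x. norm (d\<phi> n x) powr p \<partial>?M) \<le> K powr p" by (simp add: Kp)
        qed
        finally have 1: "(\<integral>\<^sup>+x. ennreal (norm (d\<phi> n x) powr p) \<partial>lborel) \<le> ennreal (K powr p)" .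
        have "(\<integral>\<^sup>+x. ennreal \<bar>\<phi> n x\<bar> \<partial>lborel) = ennreal (\<integral>x. \<bar>\<phi> n x\<bar> \<partial>?M)"
          using z1 by (intro compact_support_integrals(2)[OF _ _ Kc _ \<Omega>(1)] continuous_intros c\<phi>) auto
        then have 2: "(\<integral>\<^sup>+x. ennreal \<bar>\<phi> n x\<bar> \<partial>lborel) < \<infinity>" by simp
        have "emeasure lborel {x. t < \<bar>\<phi> n x\<bar>} \<le> ennreal c"
          using weak_sobolev_C1[OF D cd p K t 1 2] by (simp add: c_def D_def C_def N_def mult.assoc)
        moreover have "{x \<in> \<Omega>. t < \<bar>\<phi> n x\<bar>} = {x. t < \<bar>\<phi> n x\<bar>}"
        proof (intro equalityI subsetI)
          fix x assume "x \<in> {x. t < \<bar>\<phi> n x\<bar>}"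
          then have "t < \<bar>\<phi> n x\<bar>" by simp
          moreover from this t z1[of x] have "x \<in> ?K" by fastforce
          ultimately show "x \<in> {x \<in> \<Omega>. t < \<bar>\<phi> n x\<bar>}" using Kc(2) by blast
        qed blast
        moreover have "emeasure lborel {x. t < \<bar>\<phi> n x\<bar>} = emeasure lebesgue {x. t < \<bar>\<phi> n x\<bar>}"
          by simp
        moreover have "emeasure ?M {x \<in> \<Omega>. t < \<bar>\<phi> n x\<bar>} = emeasure lebesgue {x \<in> \<Omega>. t < \<bar>\<phi> n x\<bar>}"
          by (rule emeasure_restrict_space) (use \<Omega>M in auto)
        ultimately have "emeasure ?M {x \<in> \<Omega>. t < \<bar>\<phi> n x\<bar>} \<le> ennreal c"
          by (simp only:)
        then show ?thesis
          using c by (simp add: emeasure_eq_measure)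
      qed
      have le: "measure ?M E \<le> c + 1 / t powr p * (\<integral>x. norm (\<phi> n x - w x) powr p \<partial>?M)"
        if "(\<integral>x. norm (d\<phi> n x - g x) powr p \<partial>?M) < J - I" for n
      proof -
        have [measurable]: "\<phi> n \<in> borel_measurable ?M" using l\<phi> by (simp add: Lp_fun_def)
        have m: "{x \<in> \<Omega>. t < \<bar>\<phi> n x\<bar>} \<in> sets ?M" "{x \<in> \<Omega>. t powr p \<le> norm (\<phi> n x - w x) powr p} \<in> sets ?M"
        proof -
          have "{x \<in> space ?M. t < \<bar>\<phi> n x\<bar>} \<in> sets ?M" by measurable
          then show "{x \<in> \<Omega>. t < \<bar>\<phi> n x\<bar>} \<in> sets ?M" by (simp only: sp)
          have "{x \<in> space ?M. t powr p \<le> norm (\<phi> n x - w x) powr p} \<in> sets ?M" by measurable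
          then show "{x \<in> \<Omega>. t powr p \<le> norm (\<phi> n x - w x) powr p} \<in> sets ?M" by (simp only: sp)
        qed
        \<comment> \<open>Where \<open>w\<close> is at least \<open>2 * t\<close> in modulus, either
          the approximant exceeds \<open>t\<close>, or it differs from \<open>w\<close> by at least
          \<open>t\<close>; the second set is small by Markov's inequality.\<close>
        have "measure ?M E \<le> measure ?M ({x \<in> \<Omega>. t < \<bar>\<phi> n x\<bar>} \<union> {x \<in> \<Omega>. t powr p \<le> norm (\<phi> n x - w x) powr p})"
        proof (rule finite_measure_mono)
          show "E \<subseteq> {x \<in> \<Omega>. t < \<bar>\<phi> n x\<bar>} \<union> {x \<in> \<Omega>. t powr p \<le> norm (\<phi> n x - w x) powr p}"
          proof
            fix x assume "x \<in> E"
            then have x: "x \<in> \<Omega>" "2 * t \<le> \<bar>w x\<bar>" by (auto simp: E_def)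
            show "x \<in> {x \<in> \<Omega>. t < \<bar>\<phi> n x\<bar>} \<union> {x \<in> \<Omega>. t powr p \<le> norm (\<phi> n x - w x) powr p}"
            proof (cases "t < \<bar>\<phi> n x\<bar>")
              case False
              then have "t powr p \<le> \<bar>\<phi> n x - w x\<bar> powr p"
                using x t p by (intro powr_mono2) auto
              then show ?thesis using x by auto
            qed (use x in auto)
          qed
        qed (intro sets.Un m)
        also have "\<dots> \<le> measure ?M {x \<in> \<Omega>. t < \<bar>\<phi> n x\<bar>} + measure ?M {x \<in> \<Omega>. t powr p \<le> norm (\<phi> n x - w x) powr p}"
          by (intro measure_Un_le m)
        also have "measure ?M {x \<in> \<Omega>. t powr p \<le> norm (\<phi> n x - w x) powr p} \<le> (\<integral>x. norm (\<phi> n x - w x) powr p \<partial>?M) / t powr p"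
          using integral_Markov_inequality_measure[of ?M "\<lambda>x. norm (\<phi> n x - w x) powr p" "{}" "t powr p"]
            Lp_fun_diff[OF p(1) l\<phi>(1) w, of n] t by (simp add: Lp_fun_def)
        finally show ?thesis using far[OF that] by simp
      qed
      have "(\<lambda>n. c + 1 / t powr p * (\<integral>x. norm (\<phi> n x - w x) powr p \<partial>?M)) \<longlonglongrightarrow> c + 1 / t powr p * 0"
        by (intro tendsto_intros conv)
      moreover have "eventually (\<lambda>n. measure ?M E \<le> c + 1 / t powr p * (\<integral>x. norm (\<phi> n x - w x) powr p \<partial>?M)) sequentially"
        by (rule eventually_mono[OF order_tendstoD(2)[OF convd, of "J - I"] le]) (use J in simp_all)
      ultimately have "measure ?M E \<le> c"
        by (intro tendsto_lowerbound[where F=sequentially and f = "\<lambda>n. c + 1 / t powr p * (\<integral>x. norm (\<phi> n x - w x) powr p \<partial>?M)"]) auto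
      then have "measure ?M E powr ((N - p) / N) \<le> c powr ((N - p) / N)"
        using N by (intro powr_mono2) auto
      also have "\<dots> = D powr ((N - p) / N) * (K / t) powr p"
        using N D K t by (simp add: c_def powr_mult powr_powr)
      also have "\<dots> = S * J / t powr p"
        using K t J0 by (simp add: powr_divide Kp S_def)
      finally show ?thesis using t by (simp add: field_simps)
    qed
    have "t powr p * measure ?M E powr ((N - p) / N) \<le> S * I"
    proof (rule tendsto_lowerbound)
      show "((\<lambda>J. S * J) \<longlongrightarrow> S * I) (at_right I)" by (intro tendsto_intros)
      show "eventually (\<lambda>J. t powr p * measure ?M E powr ((N - p) / N) \<le> S * J) (at_right I)"
        using main by (auto simp: eventually_at_filter)
    qed simp
    then show "t powr p * measure ?M {x \<in> \<Omega>. 2 * t \<le> \<bar>w1 x - w2 x\<bar>} powr ((real DIM('a) - p) / real DIM('a))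
        \<le> S * (\<integral>x. norm (g1 x - g2 x) powr p \<partial>?M)"
      by (simp add: E_def I_def w_def g_def N_def)
  qed
qed

section \<open>Pointwise estimates\<close>

text \<open>Comparing \<open>a\<close> with \<open>b powr (q - 1)\<close> decides which of the two
  powers dominates the product, so the constant 1 is enough.\<close>

lemma young_powr:
  fixes a b q :: real
  assumes "0 \<le> a" "0 \<le> b" "1 < q"
  shows "a * b \<le> a powr (q / (q - 1)) + b powr q"
proof (cases "a \<le> b powr (q - 1)")
  case True
  then have "a * b \<le> b powr (q - 1) * b" using assms by (intro mult_right_mono)
  also have "\<dots> = b powr q" using assms by (cases "b = 0") (auto simp: powr_diff)
  finally show ?thesis using powr_ge_zero[of a "q / (q - 1)"] by linarith
next
  case False
  then have a: "a > 0" using powr_ge_zero[of b "q - 1"] by linarith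
  have "b = (b powr (q - 1)) powr (1 / (q - 1))" using assms by (simp add: powr_powr)
  also have "\<dots> \<le> a powr (1 / (q - 1))" using False assms by (intro powr_mono2) auto
  finally have "a * b \<le> a powr 1 * a powr (1 / (q - 1))" using a by simp
  also have "\<dots> = a powr (q / (q - 1))"
    unfolding powr_add[symmetric] using assms by (intro arg_cong2[where f="(powr)"]) (auto simp: field_simps)
  finally show ?thesis using powr_ge_zero[of b q] by linarith
qed

lemma Lp_inner_integrable:
  fixes F G :: "'b \<Rightarrow> 'a::euclidean_space"
  assumes "1 < p" "Lp_fun M (p / (p - 1)) F" "Lp_fun M p G"
  shows "integrable M (\<lambda>x. F x \<bullet> G x)"
proof (rule Bochner_Integration.integrable_bound)
  show "integrable M (\<lambda>x. norm (F x) powr (p / (p - 1)) + norm (G x) powr p)"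
    using assms by (auto simp: Lp_fun_def)
  have [measurable]: "F \<in> borel_measurable M" "G \<in> borel_measurable M"
    using assms by (auto simp: Lp_fun_def)
  show "(\<lambda>x. F x \<bullet> G x) \<in> borel_measurable M" by measurable
  show "AE x in M. norm (F x \<bullet> G x) \<le> norm (norm (F x) powr (p / (p - 1)) + norm (G x) powr p)"
  proof (rule AE_I2)
    fix x
    have "norm (F x \<bullet> G x) \<le> norm (F x) * norm (G x)" using Cauchy_Schwarz_ineq2 by auto
    also have "\<dots> \<le> norm (F x) powr (p / (p - 1)) + norm (G x) powr p"
      using assms by (intro young_powr) auto
    finally show "norm (F x \<bullet> G x) \<le> norm (norm (F x) powr (p / (p - 1)) + norm (G x) powr p)" by simp
  qed
qed

lemma Lp_fun_if:
  assumes "Lp_fun M p G" and P: "Measurable.pred M P" and "1 < p"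
  shows "Lp_fun M p (\<lambda>x. if P x then G x else 0)"
proof -
  have [measurable]: "G \<in> borel_measurable M" and i: "integrable M (\<lambda>x. norm (G x) powr p)"
    using assms by (auto simp: Lp_fun_def)
  note [measurable] = P
  show ?thesis
    unfolding Lp_fun_def
  proof
    show "(\<lambda>x. if P x then G x else 0) \<in> borel_measurable M" by measurable
    show "integrable M (\<lambda>x. norm (if P x then G x else 0) powr p)"
      by (rule Bochner_Integration.integrable_bound[OF i]) auto
  qed
qed

lemma tail_integral_tendsto_0:
  fixes u g :: "'b \<Rightarrow> real" and t :: "nat \<Rightarrow> real"
  assumes g: "integrable M g" and [measurable]: "u \<in> borel_measurable M"
    and t: "filterlim t at_top sequentially"
  shows "(\<lambda>i. \<integral>x. (if t i < u x then g x else 0) \<partial>M) \<longlonglongrightarrow> 0"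
proof -
  have [measurable]: "g \<in> borel_measurable M" using g by auto
  have "(\<lambda>i. \<integral>x. (if t i < u x then g x else 0) \<partial>M) \<longlonglongrightarrow> (\<integral>x. 0 \<partial>M)"
  proof (rule integral_dominated_convergence[where w="\<lambda>x. \<bar>g x\<bar>"])
    show "AE x in M. (\<lambda>i. if t i < u x then g x else 0) \<longlonglongrightarrow> 0"
    proof (rule AE_I2)
      fix x
      have "eventually (\<lambda>i. u x \<le> t i) sequentially"
        using t by (simp add: filterlim_at_top)
      then have "eventually (\<lambda>i. (if t i < u x then g x else 0) = 0) sequentially"
        by eventually_elim auto
      then show "(\<lambda>i. if t i < u x then g x else 0) \<longlonglongrightarrow> 0" by (rule tendsto_eventually)
    qed
  qed (use g in auto)
  then show ?thesis by simp
qed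

text \<open>The half-open intervals tile one long interval. This is what lets the cross terms of all
  levels together cost no more than those of a single wide band.\<close>

lemma sum_consecutive_intervals:
  fixes a k s :: real
  assumes "k > 0"
  shows "(\<Sum>i<n. if a + real i * k < s \<and> s \<le> a + real i * k + k then c else 0)
    = (if a < s \<and> s \<le> a + real n * k then c else (0::real))"
proof (induction n)
  case (Suc n)
  define X where "X = a + real n * k"
  have X: "a \<le> X" "a + real (Suc n) * k = X + k"
    using assms by (simp_all add: X_def algebra_simps)
  show ?case
    unfolding sum.lessThan_Suc Suc.IH X(2) X_def[symmetric] using X(1) assms by auto
qed (auto)

text \<open>The product of the two norm bounds expands into four terms, each controlled by Young's
  inequality, whence the 4. The condition on \<open>w\<close> covers \<open>v1\<close>,
  \<open>v2\<close> and \<open>v1 - v2\<close> at once, and \<open>r\<close> selects the solution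
  whose growth bound is used.\<close>

lemma flux_inner_le:
  fixes a w v1 v2 :: "'a::euclidean_space"
  assumes "norm a \<le> \<beta> * (l + r powr (p - 1))" "norm w \<le> norm v1 + norm v2"
    and "r = norm v1 \<or> r = norm v2" "0 \<le> l" "0 < \<beta>" "1 < p"
  shows "\<bar>a \<bullet> w\<bar> \<le> 4 * \<beta> * (l powr (p / (p - 1)) + norm v1 powr p + norm v2 powr p)"
proof -
  let ?Z = "l powr (p / (p - 1)) + norm v1 powr p + norm v2 powr p"
  have l1: "l * norm v1 \<le> ?Z"
    using young_powr[OF assms(4) norm_ge_zero[of v1] assms(6)] powr_ge_zero[of "norm v2" p] by linarith
  have l2: "l * norm v2 \<le> ?Z"
    using young_powr[OF assms(4) norm_ge_zero[of v2] assms(6)] powr_ge_zero[of "norm v1" p] by linarith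
  have r: "r powr (p - 1) * s \<le> r powr p + s powr p" if "s \<ge> 0" for s
    using young_powr[of "r powr (p - 1)" s p] assms that by (auto simp: powr_powr)
  have rr: "r powr (p - 1) * norm v1 \<le> ?Z" "r powr (p - 1) * norm v2 \<le> ?Z"
  proof -
    have m: "r powr (p - 1) * r = r powr p"
      using assms(3) by (cases "r = 0") (auto simp: powr_diff)
    have z: "0 \<le> l powr (p / (p - 1))" "0 \<le> norm v1 powr p" "0 \<le> norm v2 powr p" by auto
    show "r powr (p - 1) * norm v1 \<le> ?Z"
      using assms(3)
    proof
      assume rv: "r = norm v1" show ?thesis using m z unfolding rv by linarith
    next
      assume rv: "r = norm v2" show ?thesis using r[OF norm_ge_zero[of v1]] z unfolding rv by linarith
    qed
    show "r powr (p - 1) * norm v2 \<le> ?Z"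
      using assms(3)
    proof
      assume rv: "r = norm v1" show ?thesis using r[OF norm_ge_zero[of v2]] z unfolding rv by linarith
    next
      assume rv: "r = norm v2" show ?thesis using m z unfolding rv by linarith
    qed
  qed
  have "\<bar>a \<bullet> w\<bar> \<le> norm a * norm w" by (rule Cauchy_Schwarz_ineq2)
  also have "\<dots> \<le> (\<beta> * (l + r powr (p - 1))) * (norm v1 + norm v2)"
    using assms by (intro mult_mono) auto
  also have "\<dots> = \<beta> * (l * norm v1 + l * norm v2 + r powr (p - 1) * norm v1 + r powr (p - 1) * norm v2)"
    by (simp add: algebra_simps)
  also have "\<dots> \<le> \<beta> * (4 * ?Z)"
    using assms l1 l2 rr by (intro mult_left_mono) auto
  finally show ?thesis by (simp only: mult.assoc mult.left_commute[of \<beta>])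
qed

text \<open>The non-strict set \<open>\<bar>u1 - trunc j u2\<bar> \<le> k\<close> causes no trouble: where a level set is hit exactly,
  the extra terms have a favourable sign, so no result on gradients vanishing on level sets is needed.\<close>
lemma flux_sum_lower_bound:
  fixes a1 a2 v1 v2 :: "'a::euclidean_space" and b :: "real \<Rightarrow> real"
  assumes u: "0 \<le> u1" "0 \<le> u2" and k: "0 < k" "k \<le> j"
    and co: "0 \<le> a1 \<bullet> v1" "0 \<le> a2 \<bullet> v2"
    and gr: "norm a1 \<le> \<beta> * (l + norm v1 powr (p - 1))" "norm a2 \<le> \<beta> * (l + norm v2 powr (p - 1))"
    and mo: "0 \<le> (a1 - a2) \<bullet> (v1 - v2)"
    and b: "\<And>s. 0 < b s" "\<And>s. b s \<le> B" "\<And>s t. \<bar>b s - b t\<bar> \<le> L * \<bar>s - t\<bar>" "0 \<le> L"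
    and p: "1 < p" and \<beta>: "0 < \<beta>" and l: "0 \<le> l"
  defines "Z \<equiv> l powr (p / (p - 1)) + norm v1 powr p + norm v2 powr p"
  shows "- (if u1 \<le> j \<and> u2 \<le> j \<and> u1 \<noteq> u2 \<and> \<bar>u1 - u2\<bar> \<le> k then 4 * \<beta> * L * k * Z else 0)
      - (if j < u1 \<and> u1 \<le> j + k \<and> j - k \<le> u2 \<and> u2 \<le> j then 4 * \<beta> * B * Z else 0)
      - (if j < u2 \<and> u2 \<le> j + k \<and> j - k \<le> u1 \<and> u1 \<le> j then 4 * \<beta> * B * Z else 0)
    \<le> b u1 * (a1 \<bullet> (if \<bar>u1 - trunc j u2\<bar> \<le> k then v1 - (if \<bar>u2\<bar> \<le> j then v2 else 0) else 0))
     + b u2 * (a2 \<bullet> (if \<bar>u2 - trunc j u1\<bar> \<le> k then v2 - (if \<bar>u1\<bar> \<le> j then v1 else 0) else 0))"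
    (is "?L \<le> ?R1 + ?R2")
proof -
  have tr: "trunc j s = (if s \<le> j then s else j)" if "0 \<le> s" for s
    using that k by (auto simp: trunc_def)
  have Z0: "0 \<le> Z" by (simp add: Z_def)
  have B0: "0 \<le> B" using b(1)[of 0] b(2)[of 0] by linarith
  have cross: "- (4 * \<beta> * B * Z) \<le> - (b s * (a \<bullet> w))"
    if "\<bar>a \<bullet> w\<bar> \<le> 4 * \<beta> * Z" for a w :: 'a and s
  proof -
    have "b s * (a \<bullet> w) \<le> b s * (4 * \<beta> * Z)" using that b(1)[of s] by (intro mult_left_mono) auto
    also have "\<dots> \<le> B * (4 * \<beta> * Z)" using b(2)[of s] Z0 \<beta> by (intro mult_right_mono) auto
    finally show ?thesis by (simp add: algebra_simps)
  qed
  have c1: "\<bar>a1 \<bullet> v2\<bar> \<le> 4 * \<beta> * Z" "\<bar>a2 \<bullet> v1\<bar> \<le> 4 * \<beta> * Z" "\<bar>a2 \<bullet> (v1 - v2)\<bar> \<le> 4 * \<beta> * Z"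
    unfolding Z_def
    by (rule flux_inner_le[OF gr(1) _ _ l \<beta> p] flux_inner_le[OF gr(2) _ _ l \<beta> p];
        use norm_triangle_ineq4[of v1 v2] in simp)+
  have n0: "0 \<le> b u1 * (a1 \<bullet> v1)" "0 \<le> b u2 * (a2 \<bullet> v2)"
    using b(1) co by (simp_all add: less_imp_le)
  consider "u1 \<le> j" "u2 \<le> j" | "u1 > j" "u2 \<le> j" | "u1 \<le> j" "u2 > j" | "u1 > j" "u2 > j"
    by linarith
  then show ?thesis
  proof cases
    case 1
    show ?thesis
    proof (cases "\<bar>u1 - u2\<bar> \<le> k")
      case True
      have L: "?L = - (if u1 = u2 then 0 else 4 * \<beta> * L * k * Z)"
        using 1 True by simp
      have "?R1 + ?R2 = b u1 * (a1 \<bullet> (v1 - v2)) + b u2 * (a2 \<bullet> (v2 - v1))"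
        using 1 True u by (simp add: tr abs_minus_commute)
      \<comment> \<open>Freezing the coefficient at \<open>b u1\<close> leaves the monotone part,
        which is nonnegative, and a remainder with factor \<open>b u1 - b u2\<close>. The remainder
        vanishes for \<open>u1 = u2\<close>, so this case can be cut out of the lower bound; only
        then does the remaining set shrink to the empty set with \<open>k\<close>.\<close>
      also have "\<dots> = b u1 * ((a1 - a2) \<bullet> (v1 - v2)) + (b u1 - b u2) * (a2 \<bullet> (v1 - v2))"
        by (simp add: inner_diff_left inner_diff_right algebra_simps)
      also have "\<dots> \<ge> (b u1 - b u2) * (a2 \<bullet> (v1 - v2))"
        using mo b(1)[of u1] by simp
      also have "(b u1 - b u2) * (a2 \<bullet> (v1 - v2)) \<ge> - (if u1 = u2 then 0 else 4 * \<beta> * L * k * Z)"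
      proof (cases "u1 = u2")
        case False
        have "\<bar>(b u1 - b u2) * (a2 \<bullet> (v1 - v2))\<bar> \<le> (L * k) * (4 * \<beta> * Z)"
          unfolding abs_mult
          using b(3)[of u1 u2] True c1 b(4) mult_left_mono[OF True b(4)] by (intro mult_mono) (auto simp: k less_imp_le)
        then show ?thesis using False by (simp add: algebra_simps)
      qed simp
      finally show ?thesis by (simp only: L)
    next
      case False
      then show ?thesis using 1 u by (simp add: tr abs_minus_commute)
    qed
  next
    case 2
    \<comment> \<open>The truncation of \<open>u1\<close> is constant here and contributes no
      gradient, so the second flux is a coercive diagonal term or 0. Only the first flux carries a
      cross term.\<close>
    have r2: "?R2 \<ge> 0" using 2 u n0 by (simp add: tr)
    show ?thesis
    proof (cases "u1 - u2 \<le> k")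
      case True
      have "?R1 = b u1 * (a1 \<bullet> v1) - b u1 * (a1 \<bullet> v2)"
        using 2 u True by (simp add: tr inner_diff_right algebra_simps)
      then have "?R1 \<ge> - (4 * \<beta> * B * Z)" using cross[OF c1(1), of u1] n0 by linarith
      then show ?thesis using 2 True r2 by simp
    next
      case False
      then have "?R1 = 0" using 2 u by (simp add: tr)
      moreover have "?L \<le> 0" using 2 Z0 B0 \<beta> by simp
      ultimately show ?thesis using r2 by linarith
    qed
  next
    case 3
    have r1: "?R1 \<ge> 0" using 3 u n0 by (simp add: tr)
    show ?thesis
    proof (cases "u2 - u1 \<le> k")
      case True
      have "?R2 = b u2 * (a2 \<bullet> v2) - b u2 * (a2 \<bullet> v1)"
        using 3 u True by (simp add: tr inner_diff_right algebra_simps)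
      then have "?R2 \<ge> - (4 * \<beta> * B * Z)" using cross[OF c1(2), of u2] n0 by linarith
      then show ?thesis using 3 True r1 by simp
    next
      case False
      then have "?R2 = 0" using 3 u by (simp add: tr)
      moreover have "?L \<le> 0" using 3 Z0 B0 \<beta> by simp
      ultimately show ?thesis using r1 by linarith
    qed
  next
    case 4
    have "?R1 \<ge> 0" "?R2 \<ge> 0" using 4 u n0 by (simp_all add: tr)
    moreover have "?L = 0" using 4 by simp
    ultimately show ?thesis by linarith
  qed
qed

text \<open>For \<open>k \<le> 1\<close> one has \<open>k * min 1 r \<le> min k r\<close>, so the
  gap can be written as \<open>k\<close> times a quantity that depends on neither \<open>k\<close>
  nor the level \<open>j\<close>, and it survives the averaging over levels unchanged. The bound
  \<open>n0\<close> keeps it fixed while \<open>n\<close> grows. The opposite order of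
  \<open>u1\<close> and \<open>u2\<close> follows by exchange.\<close>

lemma source_sum_le:
  fixes H :: "real \<Rightarrow> real"
  assumes u: "0 \<le> u1" "u1 < u2" and k: "0 < k" "k \<le> 1" and j: "n \<le> j" "n0 \<le> n" "1 \<le> n"
    and f: "0 < f" and H: "0 \<le> H u2" "H u2 < H u1"
  shows "H u1 * (f * trunc k (u1 - trunc j u2)) + H u2 * (f * trunc k (u2 - trunc j u1))
    \<le> - k * (if u1 \<le> n0 \<and> u2 \<le> n0 then f * (H u2 - H u1) * trunc 1 (u1 - u2) else 0)
      + k * ((if n < u1 then H u1 * f else 0) + (if n < u2 then H u2 * f else 0))"
proof -
  have tr: "trunc j s = (if s \<le> j then s else j)" if "0 \<le> s" for s
    using that j by (auto simp: trunc_def)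
  have tk: "trunc k s \<le> k" for s using k by (auto simp: trunc_def)
  have up: "H s * (f * trunc k r) \<le> k * (H s * f)" if "0 \<le> H s" for s r
  proof -
    have "H s * f * trunc k r \<le> H s * f * k" using that f tk by (intro mult_left_mono) auto
    then show ?thesis by (simp add: algebra_simps)
  qed
  have H1: "0 \<le> H u1" using H by linarith
  consider "u2 \<le> j" | "u1 \<le> j" "j < u2" | "j < u1" using u by linarith
  then show ?thesis
  proof cases
    case 1
    have d: "trunc k (u1 - u2) = - min k (u2 - u1)" "trunc k (u2 - u1) = min k (u2 - u1)"
      "trunc 1 (u1 - u2) = - min 1 (u2 - u1)"
      using u k by (auto simp: trunc_def)
    have le: "k * min 1 (u2 - u1) \<le> min k (u2 - u1)"
      using k u by (auto simp: min_def mult_left_le_one_le mult_le_cancel_left1)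
    have t: "0 \<le> k * ((if n < u1 then H u1 * f else 0) + (if n < u2 then H u2 * f else 0))"
      using k H H1 f by simp
    have "H u1 * (f * trunc k (u1 - trunc j u2)) + H u2 * (f * trunc k (u2 - trunc j u1))
      = - (f * (H u1 - H u2) * min k (u2 - u1))"
      using 1 u by (simp add: tr d algebra_simps)
    also have "\<dots> \<le> - (f * (H u1 - H u2) * (k * min 1 (u2 - u1)))"
      using mult_left_mono[OF le, of "f * (H u1 - H u2)"] f H by simp
    also have "\<dots> \<le> - k * (if u1 \<le> n0 \<and> u2 \<le> n0 then f * (H u2 - H u1) * trunc 1 (u1 - u2) else 0)"
    proof (cases "u1 \<le> n0 \<and> u2 \<le> n0")
      case True
      then show ?thesis by (simp add: d algebra_simps)
    next
      case False
      have "0 \<le> f * (H u1 - H u2) * (k * min 1 (u2 - u1))"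
        using f H k u by simp
      then show ?thesis using False by (simp add: if_not_P)
    qed
    finally show ?thesis using t by linarith
  next
    \<comment> \<open>The source term of the smaller solution has a favourable sign even after
      truncation of the larger one, so only the term of \<open>u2\<close> is paid for, and
      \<open>u2\<close> lies in its tail. The gap term is 0 because \<open>u2\<close> exceeds
      \<open>n0\<close>.\<close>
    case 2
    have "trunc k (u1 - j) \<le> 0" using 2 k by (auto simp: trunc_def)
    then have "H u1 * (f * trunc k (u1 - trunc j u2)) \<le> 0"
      using 2 u f H1 by (simp add: tr mult_nonneg_nonpos)
    moreover have "H u2 * (f * trunc k (u2 - trunc j u1)) \<le> k * (H u2 * f)"
      by (rule up[OF H(1)])
    moreover have "0 \<le> k * (H u1 * f)" using k H1 f by simp
    moreover have "n < u2" "\<not> u2 \<le> n0" using 2 j by auto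
    ultimately show ?thesis by (auto simp: algebra_simps)
  next
    case 3
    then have "n < u2" "\<not> u2 \<le> n0" "n < u1" using 3 j u by auto
    then show ?thesis using up[OF H(1), of "u2 - trunc j u1"] up[OF H1, of "u1 - trunc j u2"]
      by (auto simp: algebra_simps)
  qed
qed

section \<open>Entropy solutions\<close>

text \<open>The body of \<open>entropy_solution\<close> with the generalized gradient \<open>v\<close> exposed.\<close>
definition entropy_pair ::
  "'a::euclidean_space set \<Rightarrow> real \<Rightarrow> ('a \<Rightarrow> 'a \<Rightarrow> 'a) \<Rightarrow> (real \<Rightarrow> real)
     \<Rightarrow> (real \<Rightarrow> ereal) \<Rightarrow> ('a \<Rightarrow> real) \<Rightarrow> ('a \<Rightarrow> real) \<Rightarrow> ('a \<Rightarrow> 'a) \<Rightarrow> bool" where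
  "entropy_pair \<Omega> p A b h f u v \<longleftrightarrow>
     u \<in> borel_measurable (lebesgue_on \<Omega>) \<and> (AE x in lebesgue_on \<Omega>. 0 \<le> u x)
   \<and> v \<in> borel_measurable (lebesgue_on \<Omega>) \<and>
       (\<forall>k>0.
          W01p0 \<Omega> p (\<lambda>x. trunc k (u x)) (\<lambda>x. if \<bar>u x\<bar> \<le> k then v x else 0)
        \<and> Lp_fun (lebesgue_on \<Omega>) (p / (p - 1))
            (\<lambda>x. b (trunc k (u x)) *\<^sub>R A x (if \<bar>u x\<bar> \<le> k then v x else 0))
        \<and> (\<forall>\<phi> \<psi>. W01p0 \<Omega> p \<phi> \<psi> \<and> (\<exists>M. AE x in lebesgue_on \<Omega>. \<bar>\<phi> x\<bar> \<le> M) \<longrightarrow>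
             ereal_L1 (lebesgue_on \<Omega>) (\<lambda>x. h (u x) * ereal (f x * trunc k (u x - \<phi> x)))
           \<and> integral\<^sup>L (lebesgue_on \<Omega>)
               (\<lambda>x. b (u x) * (A x (v x) \<bullet> (if \<bar>u x - \<phi> x\<bar> \<le> k then v x - \<psi> x else 0)))
             \<le> integral\<^sup>L (lebesgue_on \<Omega>)
               (\<lambda>x. real_of_ereal (h (u x) * ereal (f x * trunc k (u x - \<phi> x))))))"

lemma entropy_solution_iff_pair: "entropy_solution \<Omega> p A b h f u \<longleftrightarrow> (\<exists>v. entropy_pair \<Omega> p A b h f u v)"
  unfolding entropy_solution_def entropy_pair_def by blast

text \<open>Of \<open>f\<close>, only positivity and integrability are fixed here; higher
  summability enters later, in the decay lemmas. \<open>L\<close> and \<open>B\<close> name a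
  Lipschitz constant and an upper bound of \<open>b\<close>.\<close>

locale singular_problem =
  fixes \<Omega> :: "'a::euclidean_space set" and p \<beta> \<alpha> \<theta> \<gamma> c\<^sub>2 s\<^sub>2 L B :: real
    and A :: "'a \<Rightarrow> 'a \<Rightarrow> 'a" and l :: "'a \<Rightarrow> real"
    and b :: "real \<Rightarrow> real" and h :: "real \<Rightarrow> ereal" and f :: "'a \<Rightarrow> real"
  assumes \<Omega>: "open \<Omega>" "bounded \<Omega>"
    and p: "1 < p" "p < real DIM('a)"
    and l: "\<And>x. x \<in> \<Omega> \<Longrightarrow> 0 \<le> l x" "Lp_fun (lebesgue_on \<Omega>) (p / (p - 1)) l"
    and \<beta>: "\<beta> > 0"
    and A_U: "AE x in lebesgue_on \<Omega>. \<forall>\<xi> \<xi>'.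
                 A x \<xi> \<bullet> \<xi> \<ge> norm \<xi> powr p
               \<and> norm (A x \<xi>) \<le> \<beta> * (l x + norm \<xi> powr (p - 1))
               \<and> (\<xi> \<noteq> \<xi>' \<longrightarrow> (A x \<xi> - A x \<xi>') \<bullet> (\<xi> - \<xi>') > 0)"
    and b_bound: "\<And>s. b s \<le> B"
    and b_lip: "\<And>s t. \<bar>b s - b t\<bar> \<le> L * \<bar>s - t\<bar>" "0 \<le> L"
    and \<alpha>: "\<alpha> > 0" and \<theta>: "\<theta> \<ge> 0"
    and b_B: "\<And>s. b s \<ge> \<alpha> * (1 + \<bar>s\<bar>) powr (- \<theta> * (p - 1))"
    and h_nonneg: "\<And>s. s \<ge> 0 \<Longrightarrow> h s \<ge> 0"
    and h_cont: "continuous_on {0..} h"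
    and h_fin: "\<And>s. s > 0 \<Longrightarrow> h s < \<infinity>"
    and h_decr: "\<And>s t. 0 \<le> s \<Longrightarrow> s < t \<Longrightarrow> h t < h s"
    and H2: "\<gamma> \<ge> 0" "c\<^sub>2 > 0" "s\<^sub>2 > 0"
            "\<And>s. s \<ge> s\<^sub>2 \<Longrightarrow> h s \<le> ereal (c\<^sub>2 * s powr (- \<gamma>))"
    and f_int: "integrable (lebesgue_on \<Omega>) f"
    and f_pos: "AE x in lebesgue_on \<Omega>. f x > 0"
begin

abbreviation "M \<equiv> lebesgue_on \<Omega>"

abbreviation "sol \<equiv> entropy_pair \<Omega> p A b h f"

text \<open>The net growth exponent at height t: the degeneracy of \<open>b\<close> costs
  \<open>t powr (\<theta> * (p - 1))\<close>, and the decay of \<open>h\<close> gains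
  \<open>t powr - \<gamma>\<close>. Its sign separates the first two cases of the theorem.\<close>

definition "\<sigma> = \<theta> * (p - 1) - \<gamma>"

text \<open>Composition with \<open>max 0\<close> extends \<open>h\<close> continuously to the whole
  line, so that \<open>H\<close> is Borel measurable everywhere.\<close>

definition "H s = real_of_ereal (h (max 0 s))"

lemma space_M [simp]: "space M = \<Omega>" by simp

lemma \<Omega>_sets: "\<Omega> \<in> sets lebesgue" using \<Omega> by auto

lemma finite_measure_M: "finite_measure M"
  by (rule finite_measure_lebesgue_on[OF bounded_set_imp_lmeasurable[OF \<Omega>(2) \<Omega>_sets]])

lemma f_measurable [measurable]: "f \<in> borel_measurable M" using f_int by auto

lemma l_measurable [measurable]: "l \<in> borel_measurable M" using l by (auto simp: Lp_fun_def)

lemma b_pos: "0 < b s"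
proof -
  have "0 < \<alpha> * (1 + \<bar>s\<bar>) powr (- \<theta> * (p - 1))" using \<alpha> by simp
  then show ?thesis using b_B[of s] by linarith
qed

lemma b_measurable [measurable]: "b \<in> borel_measurable borel"
proof -
  have "L-lipschitz_on UNIV b"
    using b_lip by (auto simp: lipschitz_on_def dist_real_def)
  then have "continuous_on UNIV b" by (rule lipschitz_on_continuous_on)
  then show ?thesis by (rule borel_measurable_continuous_onI)
qed

lemma H_measurable [measurable]: "H \<in> borel_measurable borel"
proof -
  have "continuous_on UNIV (\<lambda>s::real. max 0 s)" by (intro continuous_intros)
  then have "continuous_on UNIV (\<lambda>s. h (max 0 s))"
    by (rule continuous_on_compose2[OF h_cont]) auto
  then have [measurable]: "(\<lambda>s. h (max 0 s)) \<in> borel_measurable borel"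
    by (rule borel_measurable_continuous_onI)
  show ?thesis unfolding H_def[abs_def] by measurable
qed

lemma H_nonneg: "0 \<le> H s"
  unfolding H_def using h_nonneg[of "max 0 s"] by (simp add: real_of_ereal_pos)

lemma h_eq_H: "h s = ereal (H s)" if "0 \<le> s" "h s \<noteq> \<infinity>"
  using that h_nonneg[of s] by (cases "h s") (auto simp: H_def max_def)

lemma H_less: "H t < H s" if "0 \<le> s" "s < t" "h s \<noteq> \<infinity>"
  using h_decr[OF that(1,2)] h_eq_H[OF that(1,3)] h_eq_H[of t] that h_fin[of t] by auto

lemma H_le: "H t \<le> H s" if "0 < s" "s \<le> t"
  using H_less[of s t] h_fin[of s] that by (cases "s = t") (auto simp: less_imp_le)

lemma H_bound: "H s \<le> c\<^sub>2 * s powr - \<gamma>" if "s\<^sub>2 \<le> s"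
  using H2(3) H2(4)[OF that] that h_eq_H[of s] h_fin[of s] by auto

lemma real_h_mult: "real_of_ereal (h s * ereal y) = H s * y" if "0 \<le> s"
  using that by (simp add: H_def max_def)

lemma sol_D:
  assumes "sol u v"
  shows "u \<in> borel_measurable M" "v \<in> borel_measurable M" "AE x in M. 0 \<le> u x"
    and "\<And>k. k > 0 \<Longrightarrow> W01p0 \<Omega> p (\<lambda>x. trunc k (u x)) (\<lambda>x. if \<bar>u x\<bar> \<le> k then v x else 0)"
  using assms unfolding entropy_pair_def by auto

lemma grad_integrable:
  assumes s: "sol u v" and "k > 0"
  shows "integrable M (\<lambda>x. if \<bar>u x\<bar> \<le> k then norm (v x) powr p else 0)"
proof -
  have "Lp_fun M p (\<lambda>x. if \<bar>u x\<bar> \<le> k then v x else 0)"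
    using sol_D(4)[OF s \<open>k > 0\<close>] by (simp add: W01p0_def)
  then have "integrable M (\<lambda>x. norm (if \<bar>u x\<bar> \<le> k then v x else 0) powr p)" by (simp add: Lp_fun_def)
  also have "(\<lambda>x. norm (if \<bar>u x\<bar> \<le> k then v x else 0) powr p) = (\<lambda>x. if \<bar>u x\<bar> \<le> k then norm (v x) powr p else 0)"
    by auto
  finally show ?thesis .
qed

text \<open>Where \<open>u\<close> is within \<open>k\<close> of \<open>\<phi>\<close> it is at most
  \<open>k + K\<close> in modulus, so the flux coincides with that of the truncation at
  \<open>k + K\<close>, which lies in the dual Lebesgue space; this gives integrability of the left
  side. The last claim is read off from finiteness of the source: an infinite \<open>h\<close> can
  only meet a vanishing factor.\<close>

lemma entropy_test:
  assumes s: "sol u v" and k: "k > 0" and W: "W01p0 \<Omega> p \<phi> \<psi>" and bd: "\<And>x. \<bar>\<phi> x\<bar> \<le> K"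
  shows "integrable M (\<lambda>x. b (u x) * (A x (v x) \<bullet> (if \<bar>u x - \<phi> x\<bar> \<le> k then v x - \<psi> x else 0)))" (is "integrable M ?G")
    and "integrable M (\<lambda>x. H (u x) * (f x * trunc k (u x - \<phi> x)))" (is "integrable M ?F")
    and "(\<integral>x. b (u x) * (A x (v x) \<bullet> (if \<bar>u x - \<phi> x\<bar> \<le> k then v x - \<psi> x else 0)) \<partial>M)
      \<le> (\<integral>x. H (u x) * (f x * trunc k (u x - \<phi> x)) \<partial>M)"
    and "AE x in M. h (u x) = \<infinity> \<longrightarrow> f x * trunc k (u x - \<phi> x) = 0"
proof -
  note [measurable] = sol_D(1,2)[OF s]
  have [measurable]: "\<phi> \<in> borel_measurable M" using W by (auto simp: W01p0_def Lp_fun_def)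
  let ?K = "k + K"
  have K: "0 < ?K" using bd[of undefined] k by linarith
  have F: "Lp_fun M (p / (p - 1)) (\<lambda>x. b (trunc ?K (u x)) *\<^sub>R A x (if \<bar>u x\<bar> \<le> ?K then v x else 0))"
    using s K unfolding entropy_pair_def by blast
  have G: "Lp_fun M p (\<lambda>x. if \<bar>u x - \<phi> x\<bar> \<le> k then (if \<bar>u x\<bar> \<le> ?K then v x else 0) - \<psi> x else 0)"
    using sol_D(4)[OF s K] W by (intro Lp_fun_if[OF Lp_fun_diff[OF p(1)] _ p(1)]) (simp_all add: W01p0_def)
  have eq: "?G = (\<lambda>x. (b (trunc ?K (u x)) *\<^sub>R A x (if \<bar>u x\<bar> \<le> ?K then v x else 0)) \<bullet>
      (if \<bar>u x - \<phi> x\<bar> \<le> k then (if \<bar>u x\<bar> \<le> ?K then v x else 0) - \<psi> x else 0))"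
  proof
    fix x
    show "?G x = (b (trunc ?K (u x)) *\<^sub>R A x (if \<bar>u x\<bar> \<le> ?K then v x else 0)) \<bullet>
      (if \<bar>u x - \<phi> x\<bar> \<le> k then (if \<bar>u x\<bar> \<le> ?K then v x else 0) - \<psi> x else 0)"
    proof (cases "\<bar>u x - \<phi> x\<bar> \<le> k")
      case True
      then have "\<bar>u x\<bar> \<le> ?K" using bd[of x] by linarith
      moreover from this have "trunc ?K (u x) = u x" by (auto simp: trunc_def)
      ultimately show ?thesis using True by simp
    qed simp
  qed
  show "integrable M ?G" unfolding eq by (rule Lp_inner_integrable[OF p(1) F G])
  have ae: "AE x in lebesgue_on \<Omega>. \<bar>\<phi> x\<bar> \<le> K" using bd by simp
  then have E: "ereal_L1 M (\<lambda>x. h (u x) * ereal (f x * trunc k (u x - \<phi> x)))"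
    and I: "(\<integral>x. ?G x \<partial>M) \<le> (\<integral>x. real_of_ereal (h (u x) * ereal (f x * trunc k (u x - \<phi> x))) \<partial>M)"
    using s k W unfolding entropy_pair_def by blast+
  have m: "?F \<in> borel_measurable M" unfolding trunc_def by measurable
  have m': "(\<lambda>x. real_of_ereal (h (u x) * ereal (f x * trunc k (u x - \<phi> x)))) \<in> borel_measurable M"
    using E by (auto simp: ereal_L1_def)
  have ae: "AE x in M. real_of_ereal (h (u x) * ereal (f x * trunc k (u x - \<phi> x))) = ?F x"
    using sol_D(3)[OF s] by eventually_elim (rule real_h_mult)
  show "integrable M ?F"
    using integrable_cong_AE[OF m' m ae] E by (simp add: ereal_L1_def)
  show "(\<integral>x. ?G x \<partial>M) \<le> (\<integral>x. ?F x \<partial>M)"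
    using integral_cong_AE[OF m' m ae] I by simp
  have "AE x in M. \<bar>h (u x) * ereal (f x * trunc k (u x - \<phi> x))\<bar> \<noteq> \<infinity>"
    using E by (simp add: ereal_L1_def)
  then show "AE x in M. h (u x) = \<infinity> \<longrightarrow> f x * trunc k (u x - \<phi> x) = 0"
    by eventually_elim (auto split: if_splits)
qed

lemma abs_trunc_le: "0 \<le> k \<Longrightarrow> \<bar>trunc k s\<bar> \<le> k"
  by (auto simp: trunc_def)

definition tail :: "('a \<Rightarrow> real) \<Rightarrow> real \<Rightarrow> real" where
  "tail u t = (\<integral>x. (if t < u x then f x else 0) \<partial>M)"

lemma tail_integrable:
  fixes u :: "'a \<Rightarrow> real"
  assumes [measurable]: "u \<in> borel_measurable M"
  shows "integrable M (\<lambda>x. if t < u x then f x else 0)"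
proof (rule Bochner_Integration.integrable_bound[OF f_int])
  show "(\<lambda>x. if t < u x then f x else 0) \<in> borel_measurable M" by measurable
qed auto

lemma tail_nonneg: "0 \<le> tail u t"
  unfolding tail_def using f_pos by (intro integral_nonneg_AE) (auto elim!: eventually_mono)

text \<open>The 3 is the height \<open>3 * t\<close> of the truncation in the energy test; the 5
  comes from \<open>1 + u x \<le> 5 * t\<close> where \<open>u x \<le> 4 * t\<close> and
  \<open>t \<ge> 1\<close>.\<close>

definition "C\<^sub>E = 3 * c\<^sub>2 * 5 powr (\<theta> * (p - 1)) / \<alpha>"

lemma C\<^sub>E_pos: "0 < C\<^sub>E" using H2 \<alpha> by (simp add: C\<^sub>E_def)

text \<open>Testing with \<open>trunc t (u x)\<close> at height \<open>3 * t\<close> leaves the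
  gradient \<open>v\<close> exactly on the band from \<open>t\<close> to \<open>4 * t\<close> and
  confines the source to \<open>t < u x\<close>. The ratio 4 is what a strip from
  \<open>n / 2\<close> to \<open>2 * n\<close> needs, with \<open>n = 2 * t\<close>.\<close>

lemma energy_estimate:
  assumes s: "sol u v" and t: "1 \<le> t" "s\<^sub>2 \<le> t"
  shows "(\<integral>x. (if t < u x \<and> u x \<le> 4 * t then norm (v x) powr p else 0) \<partial>M) \<le> C\<^sub>E * t * (t powr \<sigma> * tail u t)"
    and "integrable M (\<lambda>x. if t < u x \<and> u x \<le> 4 * t then norm (v x) powr p else 0)" (is "integrable M ?e")
proof -
  note [measurable] = sol_D(1,2)[OF s]
  have t0: "0 < t" using t by simp
  let ?G = "\<lambda>x. b (u x) * (A x (v x) \<bullet> (if \<bar>u x - trunc t (u x)\<bar> \<le> 3 * t then v x - (if \<bar>u x\<bar> \<le> t then v x else 0) else 0))"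
  let ?F = "\<lambda>x. H (u x) * (f x * trunc (3 * t) (u x - trunc t (u x)))"
  have k: "0 < 3 * t" using t0 by simp
  note T = entropy_test[OF s k sol_D(4)[OF s t0], of t, OF abs_trunc_le[OF less_imp_le[OF t0]]]
  show e: "integrable M ?e"
  proof (rule Bochner_Integration.integrable_bound[OF grad_integrable[OF s, of "4 * t"]])
    show "0 < 4 * t" using t0 by simp
    show "?e \<in> borel_measurable M" by measurable
    show "AE x in M. norm (?e x) \<le> norm (if \<bar>u x\<bar> \<le> 4 * t then norm (v x) powr p else 0)"
      using t0 by (intro AE_I2) auto
  qed
  define a where "a = \<alpha> * (5 * t) powr (- \<theta> * (p - 1))"
  have a: "0 < a" using \<alpha> t0 by (simp add: a_def)
  have "a * (\<integral>x. ?e x \<partial>M) = (\<integral>x. a * ?e x \<partial>M)" by simp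
  also have "\<dots> \<le> (\<integral>x. ?G x \<partial>M)"
  proof (rule integral_mono_AE)
    show "integrable M (\<lambda>x. a * ?e x)" using e by simp
    show "integrable M ?G" by (rule T(1))
    show "AE x in M. a * ?e x \<le> ?G x"
      using A_U sol_D(3)[OF s]
    proof eventually_elim
      case (elim x)
      have co: "norm (v x) powr p \<le> A x (v x) \<bullet> v x" using elim by blast
      have tr: "trunc t (u x) = (if u x \<le> t then u x else t)"
        using elim t0 by (auto simp: trunc_def)
      consider "u x \<le> t" | "t < u x" "u x \<le> 4 * t" | "4 * t < u x" by linarith
      then show ?case
      proof cases
        case 2
        have "a \<le> \<alpha> * (1 + \<bar>u x\<bar>) powr (- \<theta> * (p - 1))"
          unfolding a_def using 2 t \<alpha> \<theta> p elim
          by (intro mult_left_mono powr_mono2') auto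
        also have "\<dots> \<le> b (u x)" by (rule b_B)
        finally have "a * norm (v x) powr p \<le> b (u x) * (A x (v x) \<bullet> v x)"
          using co b_pos[of "u x"] by (intro mult_mono) auto
        then show ?thesis using 2 t0 elim by (simp add: tr)
      next
        case 1 then show ?thesis using t0 elim by (simp add: tr)
      next
        case 3 then show ?thesis using t0 elim by (simp add: tr)
      qed
    qed
  qed
  also have "\<dots> \<le> (\<integral>x. ?F x \<partial>M)" by (rule T(3))
  also have "\<dots> \<le> (\<integral>x. (c\<^sub>2 * t powr - \<gamma> * (3 * t)) * (if t < u x then f x else 0) \<partial>M)"
  proof (rule integral_mono_AE)
    show "integrable M ?F" by (rule T(2))
    show "integrable M (\<lambda>x. (c\<^sub>2 * t powr - \<gamma> * (3 * t)) * (if t < u x then f x else 0))"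
      by (intro integrable_mult_right tail_integrable sol_D[OF s])
    show "AE x in M. ?F x \<le> (c\<^sub>2 * t powr - \<gamma> * (3 * t)) * (if t < u x then f x else 0)"
      using f_pos sol_D(3)[OF s]
    proof eventually_elim
      case (elim x)
      show ?case
      proof (cases "t < u x")
        case False
        then have "trunc t (u x) = u x" using elim t0 by (auto simp: trunc_def)
        then show ?thesis using False t0 by (simp add: trunc_def)
      next
        case True
        have "H (u x) \<le> c\<^sub>2 * u x powr - \<gamma>" using True t by (intro H_bound) auto
        also have "\<dots> \<le> c\<^sub>2 * t powr - \<gamma>" using True t0 H2 by (intro mult_left_mono powr_mono2') auto
        finally have 1: "H (u x) \<le> c\<^sub>2 * t powr - \<gamma>" .
        have 2: "trunc (3 * t) (u x - trunc t (u x)) \<le> 3 * t"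
          using abs_trunc_le[of "3 * t"] t0 by (smt (verit))
        have 3: "0 \<le> trunc (3 * t) (u x - trunc t (u x))"
          using True t0 by (auto simp: trunc_def)
        have "?F x \<le> (c\<^sub>2 * t powr - \<gamma>) * (f x * (3 * t))"
          using 1 2 3 H_nonneg elim t0 H2 by (intro mult_mono) auto
        then show ?thesis using True by (simp add: algebra_simps)
      qed
    qed
  qed
  also have "\<dots> = c\<^sub>2 * t powr - \<gamma> * (3 * t) * tail u t" by (simp add: tail_def)
  finally have "(\<integral>x. ?e x \<partial>M) \<le> c\<^sub>2 * t powr - \<gamma> * (3 * t) * tail u t / a"
    using a by (simp add: field_simps)
  also have "\<dots> = C\<^sub>E * t * (t powr \<sigma> * tail u t)"
    using t0 \<alpha> by (simp add: a_def C\<^sub>E_def \<sigma>_def powr_mult powr_minus powr_diff powr_add field_simps)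
  finally show "(\<integral>x. ?e x \<partial>M) \<le> C\<^sub>E * t * (t powr \<sigma> * tail u t)" .
qed

end

section \<open>Comparison of two solutions\<close>

context singular_problem
begin

text \<open>If \<open>h 0 = \<infinity>\<close>, then \<open>H 0 = 0\<close> is a junk value, so points with an infinite source must be
  excluded before \<open>H\<close> can be used as a decreasing function.\<close>
lemma no_infinite_source:
  assumes s1: "sol u1 v1" and s2: "sol u2 v2"
  shows "AE x in M. h (u1 x) = \<infinity> \<longrightarrow> u1 x = u2 x"
  using entropy_test(4)[OF s1 zero_less_one sol_D(4)[OF s2 zero_less_one] abs_trunc_le[OF zero_le_one]] f_pos
    sol_D(3)[OF s1] sol_D(3)[OF s2]
proof (eventually_elim)
  case (elim x)
  show ?case
  proof
    assume i: "h (u1 x) = \<infinity>"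
    then have "u1 x = 0" using h_fin[of "u1 x"] elim by (cases "u1 x = 0") auto
    \<comment> \<open>Positivity of \<open>f\<close> turns the vanishing product into a vanishing
      truncation, and with \<open>u1 x = 0\<close> this forces \<open>u2 x = 0\<close>.\<close>
    moreover have "trunc 1 (u1 x - trunc 1 (u2 x)) = 0" using i elim by auto
    ultimately show "u1 x = u2 x" using elim by (auto simp: trunc_def min_def max_def split: if_splits)
  qed
qed

text \<open>There are \<open>m\<close> levels with spacing \<open>k = n / m\<close>. Summation
  multiplies the gap, the tails and the Lipschitz remainder by \<open>m * k = n\<close>, while the
  cross terms live on disjoint bands and do not accumulate; division by \<open>n\<close> thus puts
  the factor \<open>1 / n\<close> on \<open>Z2\<close> alone. As \<open>D\<close> involves neither
  \<open>n\<close> nor \<open>m\<close>, both may later tend to infinity. Monotonicity replaces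
  \<open>H\<close> by \<open>H 1\<close> on the tails.\<close>

lemma weighted_gap_inequality:
  assumes s1: "sol u1 v1" and s2: "sol u2 v2"
    and n: "1 \<le> n" "n0 \<le> n" and m: "2 < m" "n \<le> real m"
  defines "Z \<equiv> \<lambda>x. l x powr (p / (p - 1)) + norm (v1 x) powr p + norm (v2 x) powr p"
    and "D \<equiv> \<lambda>x. if u1 x \<le> n0 \<and> u2 x \<le> n0 then f x * (H (u2 x) - H (u1 x)) * trunc 1 (u1 x - u2 x) else 0"
  defines "Z1 \<equiv> \<lambda>x. if u1 x \<le> 2 * n \<and> u2 x \<le> 2 * n \<and> u1 x \<noteq> u2 x \<and> \<bar>u1 x - u2 x\<bar> \<le> n / real m then Z x else 0"
    and "Z2 \<equiv> \<lambda>x. if n / 2 < u1 x \<and> u1 x \<le> 2 * n \<and> n / 2 < u2 x \<and> u2 x \<le> 2 * n then Z x else 0"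
  shows "integrable M D" "integrable M Z1" "integrable M Z2"
    "(\<integral>x. D x \<partial>M) \<le> H 1 * (tail u1 n + tail u2 n) + 4 * \<beta> * L * (\<integral>x. Z1 x \<partial>M) + 8 * \<beta> * B / n * (\<integral>x. Z2 x \<partial>M)"
proof -
  note [measurable] = sol_D(1,2)[OF s1] sol_D(1,2)[OF s2]
  have m0: "0 < real m" using m by simp
  define k where "k = n / real m"
  \<comment> \<open>\<open>m > 2\<close> gives \<open>k < n / 2\<close>, which keeps the lower edge
    \<open>j i - k\<close> of every band above \<open>n / 2\<close>; \<open>n \<le> m\<close> gives
    \<open>k \<le> 1\<close>, as the source estimate requires.\<close>
  have k: "0 < k" "k \<le> 1" "k < n / 2" "real m * k = n"
    using n m m0 by (auto simp: k_def field_simps)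
  define j where "j i = n + real i * k" for i
  have j: "n \<le> j i" "0 < j i" "k \<le> j i" for i
  proof -
    have "0 \<le> real i * k" using k by simp
    then show "n \<le> j i" "0 < j i" "k \<le> j i" using n k unfolding j_def by linarith+
  qed
  have j2: "j i + k \<le> 2 * n" if "i < m" for i
  proof -
    have "real (Suc i) * k \<le> real m * k" using that k by (intro mult_right_mono) auto
    then show ?thesis using k by (simp add: j_def algebra_simps)
  qed
  define Zn where "Zn x = (if \<bar>u1 x\<bar> \<le> 2 * n \<and> \<bar>u2 x\<bar> \<le> 2 * n then Z x else 0)" for x
  have [measurable]: "Z \<in> borel_measurable M" unfolding Z_def by measurable
  have Z0: "0 \<le> Z x" for x by (simp add: Z_def)
  have Zn_int: "integrable M Zn"
  proof (rule Bochner_Integration.integrable_bound)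
    have "integrable M (\<lambda>x. l x powr (p / (p - 1)))"
    proof -
      have "integrable M (\<lambda>x. \<bar>l x\<bar> powr (p / (p - 1)))" using l(2) by (simp add: Lp_fun_def)
      moreover have "integrable M (\<lambda>x. \<bar>l x\<bar> powr (p / (p - 1))) \<longleftrightarrow> integrable M (\<lambda>x. l x powr (p / (p - 1)))"
        using l(1) by (intro Bochner_Integration.integrable_cong) auto
      ultimately show ?thesis by simp
    qed
    then show "integrable M (\<lambda>x. l x powr (p / (p - 1)) + (if \<bar>u1 x\<bar> \<le> 2 * n then norm (v1 x) powr p else 0)
      + (if \<bar>u2 x\<bar> \<le> 2 * n then norm (v2 x) powr p else 0))"
      using n by (intro Bochner_Integration.integrable_add grad_integrable[OF s1] grad_integrable[OF s2]) auto
    show "Zn \<in> borel_measurable M" unfolding Zn_def by measurable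
  qed (auto simp: Zn_def Z_def intro!: AE_I2)
  have [measurable]: "Z1 \<in> borel_measurable M" "Z2 \<in> borel_measurable M" "D \<in> borel_measurable M"
    unfolding Z1_def Z2_def D_def trunc_def by measurable
  show Z1: "integrable M Z1" and Z2: "integrable M Z2"
    using sol_D(3)[OF s1] sol_D(3)[OF s2] Z0
    by (auto intro!: Bochner_Integration.integrable_bound[OF Zn_int] simp: Z1_def Z2_def Zn_def elim!: eventually_elim2)
  define G1 where "G1 i x = b (u1 x) * (A x (v1 x) \<bullet> (if \<bar>u1 x - trunc (j i) (u2 x)\<bar> \<le> k then v1 x - (if \<bar>u2 x\<bar> \<le> j i then v2 x else 0) else 0))" for i x
  define G2 where "G2 i x = b (u2 x) * (A x (v2 x) \<bullet> (if \<bar>u2 x - trunc (j i) (u1 x)\<bar> \<le> k then v2 x - (if \<bar>u1 x\<bar> \<le> j i then v1 x else 0) else 0))" for i x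
  define F1 where "F1 i x = H (u1 x) * (f x * trunc k (u1 x - trunc (j i) (u2 x)))" for i x
  define F2 where "F2 i x = H (u2 x) * (f x * trunc k (u2 x - trunc (j i) (u1 x)))" for i x
  note T1 = entropy_test[OF s1 k(1) sol_D(4)[OF s2 j(2)], of _ "j _", OF abs_trunc_le[OF less_imp_le[OF j(2)]], folded G1_def F1_def]
  note T2 = entropy_test[OF s2 k(1) sol_D(4)[OF s1 j(2)], of _ "j _", OF abs_trunc_le[OF less_imp_le[OF j(2)]], folded G2_def F2_def]
  define E where "E x = (if n < u1 x then f x else 0) + (if n < u2 x then f x else 0)" for x
  have E: "integrable M E" "(\<integral>x. E x \<partial>M) = tail u1 n + tail u2 n"
    unfolding E_def[abs_def] tail_def using tail_integrable[of u1 n] tail_integrable[of u2 n] by auto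
  have ae: "AE x in M. D x \<ge> 0 \<and> (\<forall>i. F1 i x + F2 i x \<le> - k * D x + k * (H 1 * E x))"
    using no_infinite_source[OF s1 s2] no_infinite_source[OF s2 s1] f_pos sol_D(3)[OF s1] sol_D(3)[OF s2]
  proof eventually_elim
    case (elim x)
    have fx: "0 < f x" and ux: "0 \<le> u1 x" "0 \<le> u2 x" using elim by auto
    have t: "(if n < u1 x then H (u1 x) * f x else 0) + (if n < u2 x then H (u2 x) * f x else 0) \<le> H 1 * E x"
    proof -
      have "(if n < u x then H (u x) * f x else 0) \<le> H 1 * (if n < u x then f x else 0)" for u
        using H_le[of 1 "u x"] n fx by (auto intro!: mult_right_mono)
      from add_mono[OF this[of u1] this[of u2]] show ?thesis by (simp add: E_def distrib_left)
    qed
    have t': "k * ((if n < u1 x then H (u1 x) * f x else 0) + (if n < u2 x then H (u2 x) * f x else 0)) \<le> k * (H 1 * E x)"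
      using t k by (intro mult_left_mono) auto
    have t'': "k * ((if n < u2 x then H (u2 x) * f x else 0) + (if n < u1 x then H (u1 x) * f x else 0)) \<le> k * (H 1 * E x)"
      using t' by (simp only: add.commute)
    consider "u1 x < u2 x" | "u2 x < u1 x" | "u1 x = u2 x" by linarith
    then show ?case
    proof cases
      case 1
      have lt: "H (u2 x) < H (u1 x)" using 1 elim by (intro H_less) auto
      have "trunc 1 (u1 x - u2 x) \<le> 0" using 1 by (simp add: trunc_def)
      then have "0 \<le> f x * (H (u2 x) - H (u1 x)) * trunc 1 (u1 x - u2 x)"
        using lt fx by (intro mult_nonpos_nonpos mult_nonneg_nonpos) auto
      then have "0 \<le> D x" by (simp add: D_def)
      moreover have "F1 i x + F2 i x \<le> - k * D x + k * (H 1 * E x)" for i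
        using source_sum_le[OF ux(1) 1 k(1,2) j(1)[of i] n(2,1) fx H_nonneg lt] t'
        unfolding F1_def F2_def D_def by linarith
      ultimately show ?thesis by blast
    next
      case 2
      have lt: "H (u1 x) < H (u2 x)" using 2 elim by (intro H_less) auto
      have "trunc 1 (u1 x - u2 x) \<ge> 0" using 2 by (simp add: trunc_def)
      then have "0 \<le> f x * (H (u2 x) - H (u1 x)) * trunc 1 (u1 x - u2 x)"
        using lt fx by simp
      then have "0 \<le> D x" by (simp add: D_def)
      have sw: "(if u2 x \<le> n0 \<and> u1 x \<le> n0 then f x * (H (u1 x) - H (u2 x)) * trunc 1 (u2 x - u1 x) else 0) = D x"
        by (auto simp: D_def trunc_def min_def max_def algebra_simps)
      have "F1 i x + F2 i x \<le> - k * D x + k * (H 1 * E x)" for i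
        using source_sum_le[OF ux(2) 2 k(1,2) j(1)[of i] n(2,1) fx H_nonneg lt] t''
        unfolding F1_def F2_def sw by linarith
      with \<open>0 \<le> D x\<close> show ?thesis by blast
    next
      \<comment> \<open>Points with an infinite source fall into this case, with both values 0.
        Below the level the truncation changes nothing and the source term is 0, so the default
        value of \<open>H\<close> does no harm.\<close>
      case 3
      have D: "D x = 0" by (simp add: D_def 3)
      have Fi: "F1 i x \<le> k * (if n < u1 x then H (u1 x) * f x else 0)" if "u1 x = u2 x" for i
      proof (cases "j i < u1 x")
        case True
        then have "n < u1 x" using j(1)[of i] by linarith
        moreover have "H (u1 x) * f x * trunc k (u1 x - trunc (j i) (u2 x)) \<le> H (u1 x) * f x * k"
          using H_nonneg fx k by (intro mult_left_mono) (auto simp: trunc_def)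
        ultimately show ?thesis by (simp add: F1_def algebra_simps)
      next
        case False
        then have "trunc (j i) (u2 x) = u1 x" using 3 ux j(2)[of i] by (auto simp: trunc_def)
        then have "F1 i x = 0" using k by (simp add: F1_def trunc_def)
        then show ?thesis using k H_nonneg[of "u1 x"] fx by auto
      qed
      have "F2 i x = F1 i x" for i by (simp add: F1_def F2_def 3)
      then have "F1 i x + F2 i x \<le> k * (H 1 * E x)" for i
        using Fi[OF 3, of i] t'[folded 3, unfolded distrib_left] by simp
      then show ?thesis by (simp add: D)
    qed
  qed
  \<comment> \<open>Integrability of \<open>D\<close> is obtained from its own pointwise upper bound
    at the single level \<open>i = 0\<close>, whose ingredients are integrable by the entropy
    formulation.\<close>
  have int_bound: "integrable M (\<lambda>x. k * (H 1 * E x) - (F1 0 x + F2 0 x))"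
    using T1(2)[of 0] T2(2)[of 0] E by auto
  show D: "integrable M D"
  proof -
    have "integrable M (\<lambda>x. k * D x)"
    proof (rule Bochner_Integration.integrable_bound[OF int_bound])
      show "AE x in M. norm (k * D x) \<le> norm (k * (H 1 * E x) - (F1 0 x + F2 0 x))"
        using ae
      proof eventually_elim
        case (elim x)
        then have "0 \<le> k * D x" "k * D x \<le> k * (H 1 * E x) - (F1 0 x + F2 0 x)"
          using k by (auto simp: algebra_simps dest: spec[of _ 0])
        then show ?case by simp
      qed
    qed measurable
    from integrable_mult_right[OF this, of "1 / k"] show ?thesis using k by simp
  qed
  have low: "AE x in M. - (real m * (4 * \<beta> * L * k * Z1 x)) - 8 * \<beta> * B * Z2 x \<le> (\<Sum>i<m. G1 i x + G2 i x)"
    using A_U sol_D(3)[OF s1] sol_D(3)[OF s2] AE_space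
  proof eventually_elim
    case (elim x)
    let ?P = "\<lambda>i. if u1 x \<le> j i \<and> u2 x \<le> j i \<and> u1 x \<noteq> u2 x \<and> \<bar>u1 x - u2 x\<bar> \<le> k then 4 * \<beta> * L * k * Z x else 0"
    let ?Q1 = "\<lambda>i. if j i < u1 x \<and> u1 x \<le> j i + k \<and> j i - k \<le> u2 x \<and> u2 x \<le> j i then 4 * \<beta> * B * Z x else 0"
    let ?Q2 = "\<lambda>i. if j i < u2 x \<and> u2 x \<le> j i + k \<and> j i - k \<le> u1 x \<and> u1 x \<le> j i then 4 * \<beta> * B * Z x else 0"
    have lx: "0 \<le> l x" using l(1) elim by simp
    have B0: "0 \<le> B" using b_pos[of 0] b_bound[of 0] by linarith
    have c0: "0 \<le> 4 * \<beta> * B * Z x" using Z0 \<beta> B0 by simp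
    have mo: "0 \<le> (A x (v1 x) - A x (v2 x)) \<bullet> (v1 x - v2 x)"
      using elim by (cases "v1 x = v2 x") (auto simp: less_imp_le)
    have co: "0 \<le> A x \<xi> \<bullet> \<xi>" for \<xi> using elim(1) powr_ge_zero[of "norm \<xi>" p] order_trans by blast
    have gr: "norm (A x \<xi>) \<le> \<beta> * (l x + norm \<xi> powr (p - 1))" for \<xi> using elim(1) by blast
    have st: "- ?P i - ?Q1 i - ?Q2 i \<le> G1 i x + G2 i x" for i
      unfolding G1_def G2_def Z_def
      by (rule flux_sum_lower_bound[OF _ _ k(1) j(3) co co gr gr mo b_pos b_bound b_lip p(1) \<beta> lx])
        (use elim in auto)
    have P: "?P i \<le> 4 * \<beta> * L * k * Z1 x" if "i < m" for i
      using j2[OF that] k Z0 \<beta> b_lip(2) by (auto simp: Z1_def k_def[symmetric])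
    have Pm: "(\<Sum>i<m. ?P i) \<le> real m * (4 * \<beta> * L * k * Z1 x)"
      using sum_bounded_above[of "{..<m}" ?P] P by simp
    \<comment> \<open>The position of \<open>u2 x\<close> is first relaxed to the strip between
      \<open>n / 2\<close> and \<open>2 * n\<close>, which does not depend on \<open>i\<close>;
      after that, at most one level has \<open>u1 x\<close> in its band.\<close>
    have Q1: "(\<Sum>i<m. ?Q1 i) \<le> 4 * \<beta> * B * Z2 x"
    proof -
      let ?c = "if n / 2 < u2 x \<and> u2 x \<le> 2 * n then 4 * \<beta> * B * Z x else 0"
      have "(\<Sum>i<m. ?Q1 i) \<le> (\<Sum>i<m. if n + real i * k < u1 x \<and> u1 x \<le> n + real i * k + k then ?c else 0)"
      proof (rule sum_mono)
        fix i assume "i \<in> {..<m}"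
        then show "?Q1 i \<le> (if n + real i * k < u1 x \<and> u1 x \<le> n + real i * k + k then ?c else 0)"
          using j(1)[of i] j2[of i] k c0 unfolding j_def[symmetric] by auto
      qed
      also have "\<dots> = (if n < u1 x \<and> u1 x \<le> n + real m * k then ?c else 0)"
        by (rule sum_consecutive_intervals[OF k(1)])
      also have "\<dots> \<le> 4 * \<beta> * B * Z2 x" using c0 k n by (auto simp: Z2_def)
      finally show ?thesis .
    qed
    have Q2: "(\<Sum>i<m. ?Q2 i) \<le> 4 * \<beta> * B * Z2 x"
    proof -
      let ?c = "if n / 2 < u1 x \<and> u1 x \<le> 2 * n then 4 * \<beta> * B * Z x else 0"
      have "(\<Sum>i<m. ?Q2 i) \<le> (\<Sum>i<m. if n + real i * k < u2 x \<and> u2 x \<le> n + real i * k + k then ?c else 0)"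
      proof (rule sum_mono)
        fix i assume "i \<in> {..<m}"
        then show "?Q2 i \<le> (if n + real i * k < u2 x \<and> u2 x \<le> n + real i * k + k then ?c else 0)"
          using j(1)[of i] j2[of i] k c0 unfolding j_def[symmetric] by auto
      qed
      also have "\<dots> = (if n < u2 x \<and> u2 x \<le> n + real m * k then ?c else 0)"
        by (rule sum_consecutive_intervals[OF k(1)])
      also have "\<dots> \<le> 4 * \<beta> * B * Z2 x" using c0 k n by (auto simp: Z2_def)
      finally show ?thesis .
    qed
    have "(\<Sum>i<m. - ?P i - ?Q1 i - ?Q2 i) \<le> (\<Sum>i<m. G1 i x + G2 i x)"
      by (rule sum_mono) (rule st)
    then have "- (\<Sum>i<m. ?P i) - (\<Sum>i<m. ?Q1 i) - (\<Sum>i<m. ?Q2 i) \<le> (\<Sum>i<m. G1 i x + G2 i x)"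
      by (simp only: sum_subtractf sum_negf)
    then show ?case using Pm Q1 Q2 by linarith
  qed
  have "- (real m * (4 * \<beta> * L * k * (\<integral>x. Z1 x \<partial>M))) - 8 * \<beta> * B * (\<integral>x. Z2 x \<partial>M)
    = (\<integral>x. - (real m * (4 * \<beta> * L * k * Z1 x)) - 8 * \<beta> * B * Z2 x \<partial>M)"
    using Z1 Z2 by simp
  also have "\<dots> \<le> (\<integral>x. (\<Sum>i<m. G1 i x + G2 i x) \<partial>M)"
    using Z1 Z2 T1(1) T2(1) low by (intro integral_mono_AE) auto
  also have "\<dots> = (\<Sum>i<m. (\<integral>x. G1 i x \<partial>M) + (\<integral>x. G2 i x \<partial>M))"
    using T1(1) T2(1) by simp
  also have "\<dots> \<le> (\<Sum>i<m. (\<integral>x. F1 i x \<partial>M) + (\<integral>x. F2 i x \<partial>M))"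
    by (intro sum_mono add_mono T1(3) T2(3))
  also have "\<dots> = (\<Sum>i<m. (\<integral>x. F1 i x + F2 i x \<partial>M))"
    using T1(2) T2(2) by simp
  also have "\<dots> \<le> (\<Sum>i<m. (\<integral>x. - k * D x + k * (H 1 * E x) \<partial>M))"
  proof (rule sum_mono)
    fix i
    show "(\<integral>x. F1 i x + F2 i x \<partial>M) \<le> (\<integral>x. - k * D x + k * (H 1 * E x) \<partial>M)"
      using T1(2)[of i] T2(2)[of i] D E(1) ae by (intro integral_mono_AE) (auto elim: eventually_mono)
  qed
  also have "\<dots> = real m * (- k * (\<integral>x. D x \<partial>M) + k * (H 1 * (tail u1 n + tail u2 n)))"
    using D E by simp
  also have "\<dots> = n * (H 1 * (tail u1 n + tail u2 n) - (\<integral>x. D x \<partial>M))"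
    by (simp add: k(4)[symmetric] algebra_simps)
  also have "real m * (4 * \<beta> * L * k * (\<integral>x. Z1 x \<partial>M)) = n * (4 * \<beta> * L * (\<integral>x. Z1 x \<partial>M))"
    by (simp add: k(4)[symmetric] algebra_simps)
  finally have "n * (\<integral>x. D x \<partial>M) \<le> n * (H 1 * (tail u1 n + tail u2 n) + 4 * \<beta> * L * (\<integral>x. Z1 x \<partial>M) + 8 * \<beta> * B / n * (\<integral>x. Z2 x \<partial>M))"
    using n by (simp add: algebra_simps)
  then show "(\<integral>x. D x \<partial>M) \<le> H 1 * (tail u1 n + tail u2 n) + 4 * \<beta> * L * (\<integral>x. Z1 x \<partial>M) + 8 * \<beta> * B / n * (\<integral>x. Z2 x \<partial>M)"
    using n by simp
qed

end

section \<open>Decay of the energy and uniqueness\<close>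

text \<open>Integrating \<open>le_add_powr\<close> with \<open>s = (e / \<mu>) powr (1 / q)\<close>
  makes both terms equal, which yields Hoelder's inequality with the constant 2. For
  \<open>e = 0\<close> or \<open>\<mu> = 0\<close> this \<open>s\<close> would not be positive, so
  these cases are separate.\<close>

lemma (in finite_measure) integral_le_powr_measure:
  fixes g :: "'a \<Rightarrow> real"
  assumes q: "1 < q" and g: "integrable M g" "integrable M (\<lambda>x. \<bar>g x\<bar> powr q)" and P [measurable]: "Measurable.pred M P"
  shows "(\<integral>x. (if P x then g x else 0) \<partial>M)
    \<le> 2 * (\<integral>x. (if P x then \<bar>g x\<bar> powr q else 0) \<partial>M) powr (1 / q) * measure M {x \<in> space M. P x} powr (1 - 1 / q)"
proof -
  have [measurable]: "g \<in> borel_measurable M" using g by auto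
  let ?e = "\<lambda>x. if P x then \<bar>g x\<bar> powr q else 0"
  define e where "e = (\<integral>x. ?e x \<partial>M)"
  define \<mu> where "\<mu> = measure M {x \<in> space M. P x}"
  have ie: "integrable M ?e"
  proof (rule Bochner_Integration.integrable_bound[OF g(2)])
    show "?e \<in> borel_measurable M" by measurable
  qed auto
  have ig: "integrable M (\<lambda>x. if P x then g x else 0)"
  proof (rule Bochner_Integration.integrable_bound[OF g(1)])
    show "(\<lambda>x. if P x then g x else 0) \<in> borel_measurable M" by measurable
  qed auto
  have e0: "0 \<le> e" unfolding e_def by (rule Bochner_Integration.integral_nonneg) auto
  consider "e = 0" | "\<mu> = 0" | "0 < e" "0 < \<mu>"
    using e0 measure_nonneg[of M "{x \<in> space M. P x}"] unfolding \<mu>_def[symmetric] by linarith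
  then show ?thesis
  proof cases
    case 1
    then have "AE x in M. ?e x = 0"
      using ie by (subst (asm) e_def, subst (asm) integral_nonneg_eq_0_iff_AE) auto
    then have "AE x in M. (if P x then g x else 0) = 0" by eventually_elim (auto split: if_splits)
    then have "(\<integral>x. (if P x then g x else 0) \<partial>M) = 0" by (rule integral_eq_zero_AE)
    then show ?thesis by (simp only:) simp
  next
    case 2
    then have "emeasure M {x \<in> space M. P x} = 0" by (simp add: \<mu>_def emeasure_eq_measure)
    then have "AE x in M. \<not> P x" by (subst AE_iff_measurable[OF _ refl]) auto
    then have "AE x in M. (if P x then g x else 0) = 0" by eventually_elim auto
    then have "(\<integral>x. (if P x then g x else 0) \<partial>M) = 0" by (rule integral_eq_zero_AE)
    then show ?thesis by (simp only:) simp
  next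
    case 3
    define s where "s = (e / \<mu>) powr (1 / q)"
    have s: "0 < s" using 3 by (simp add: s_def)
    have iind: "integrable M (\<lambda>x. indicator {x \<in> space M. P x} x :: real)"
      by (intro integrable_real_indicator) (measurable, simp add: emeasure_eq_measure)
    have "(\<integral>x. (if P x then g x else 0) \<partial>M) \<le> (\<integral>x. s * indicator {x \<in> space M. P x} x + s powr (1 - q) * ?e x \<partial>M)"
    proof (rule integral_mono_AE)
      show "integrable M (\<lambda>x. s * indicator {x \<in> space M. P x} x + s powr (1 - q) * ?e x)"
        using ie iind by (intro Bochner_Integration.integrable_add integrable_mult_right)
      show "AE x in M. (if P x then g x else 0) \<le> s * indicator {x \<in> space M. P x} x + s powr (1 - q) * ?e x"
        using AE_space
      proof eventually_elim
        case (elim x)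
        have "g x \<le> s + s powr (1 - q) * \<bar>g x\<bar> powr q"
          using le_add_powr[of "\<bar>g x\<bar>" s q] s q by linarith
        then show ?case using elim by simp
      qed
    qed (rule ig)
    also have "\<dots> = s * \<mu> + s powr (1 - q) * e"
      using ie iind by (subst Bochner_Integration.integral_add) (auto simp: e_def \<mu>_def Int_absorb2 Collect_conj_eq)
    also have "s * \<mu> = e powr (1 / q) * \<mu> powr (1 - 1 / q)"
      using 3 by (simp add: s_def powr_divide powr_diff)
    also have "s powr (1 - q) * e = e powr (1 / q) * \<mu> powr (1 - 1 / q)"
    proof -
      have "s powr (1 - q) = (e / \<mu>) powr (1 / q - 1)"
        using q 3 by (simp add: s_def powr_powr diff_divide_distrib)
      then show ?thesis using 3 by (simp add: powr_divide powr_diff)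
    qed
    finally show ?thesis by (simp add: e_def \<mu>_def)
  qed
qed

text \<open>Once \<open>\<delta>\<close> is below \<open>1 / (2 * (C + 1))\<close> in modulus, the
  bound \<open>max 1 (a i0)\<close> passes on to all later terms, because the constant 1 is absorbed
  into it. Boundedness then turns the recurrence into convergence.\<close>

lemma affine_recurrence_tendsto_0:
  fixes a \<delta> :: "nat \<Rightarrow> real"
  assumes a: "\<And>i. 0 \<le> a i" and C: "0 \<le> C" and \<delta>: "\<delta> \<longlonglongrightarrow> 0"
    and rec: "eventually (\<lambda>i. a (Suc i) \<le> \<delta> i * (1 + C * a i)) sequentially"
  shows "a \<longlonglongrightarrow> 0"
proof -
  have "eventually (\<lambda>i. \<bar>\<delta> i\<bar> < 1 / (2 * (C + 1))) sequentially"
    using order_tendstoD(2)[OF tendsto_rabs[OF \<delta>], of "1 / (2 * (C + 1))"] C by simp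
  with rec have "eventually (\<lambda>i. a (Suc i) \<le> \<delta> i * (1 + C * a i) \<and> \<bar>\<delta> i\<bar> < 1 / (2 * (C + 1))) sequentially"
    by eventually_elim auto
  then obtain i0 where i0: "\<And>i. i \<ge> i0 \<Longrightarrow> a (Suc i) \<le> \<delta> i * (1 + C * a i)"
    "\<And>i. i \<ge> i0 \<Longrightarrow> \<bar>\<delta> i\<bar> < 1 / (2 * (C + 1))"
    by (auto simp: eventually_sequentially)
  define A where "A = max 1 (a i0)"
  have bd: "a i \<le> A" if "i \<ge> i0" for i
    using that
  proof (induction rule: dec_induct)
    case (step i)
    have "a (Suc i) \<le> \<delta> i * (1 + C * a i)" using step i0 by auto
    also have "\<dots> \<le> 1 / (2 * (C + 1)) * (1 + C * a i)"
      using i0(2)[of i] step C a[of i] by (intro mult_right_mono) auto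
    also have "\<dots> \<le> 1 / (2 * (C + 1)) * (A + C * A)"
      using step C by (intro mult_left_mono add_mono) (auto simp: A_def)
    also have "\<dots> = A / 2" using C by (simp add: field_simps)
    finally show ?case by (simp add: A_def)
  qed (simp add: A_def)
  have "(\<lambda>i. a (Suc i)) \<longlonglongrightarrow> 0"
  proof (rule tendsto_sandwich)
    show "eventually (\<lambda>i. 0 \<le> a (Suc i)) sequentially" using a by simp
    show "eventually (\<lambda>i. a (Suc i) \<le> \<bar>\<delta> i\<bar> * (1 + C * A)) sequentially"
      using eventually_ge_at_top[of i0]
    proof eventually_elim
      case (elim i)
      have "a (Suc i) \<le> \<delta> i * (1 + C * a i)" using elim i0 by auto
      also have "\<dots> \<le> \<bar>\<delta> i\<bar> * (1 + C * A)"
        using bd[OF elim] C a[of i] by (intro mult_mono) (auto intro: mult_left_mono)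
      finally show ?case .
    qed
    have "(\<lambda>i. \<bar>\<delta> i\<bar> * (1 + C * A)) \<longlonglongrightarrow> \<bar>0\<bar> * (1 + C * A)"
      by (intro tendsto_intros \<delta>)
    then show "(\<lambda>i. \<bar>\<delta> i\<bar> * (1 + C * A)) \<longlonglongrightarrow> 0" by simp
  qed simp
  then show ?thesis by (simp add: filterlim_sequentially_Suc)
qed

lemma filterlim_two_power: "filterlim (\<lambda>i. 2 ^ i :: real) at_top sequentially"
  by (rule filterlim_at_infinity_imp_filterlim_at_top)
    (auto intro!: filterlim_realpow_sequentially_gt1)

context singular_problem
begin

text \<open>By \<open>energy_estimate\<close>, this makes \<open>1 / t\<close> times the energy on
  the band from \<open>t\<close> to \<open>4 * t\<close> vanish along \<open>t = 2 ^ i\<close>.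
  Dyadic heights suffice because the uniqueness argument only uses
  \<open>n = 2 ^ Suc i\<close>.\<close>

definition "decays u \<longleftrightarrow> (\<lambda>i. (2 ^ i) powr \<sigma> * tail u (2 ^ i)) \<longlonglongrightarrow> 0"

lemma decays_if_nonpos:
  assumes s: "sol u v" and "\<sigma> \<le> 0"
  shows "decays u"
  unfolding decays_def
proof (rule tendsto_sandwich)
  show "eventually (\<lambda>i. 0 \<le> (2 ^ i) powr \<sigma> * tail u (2 ^ i)) sequentially"
    using tail_nonneg by simp
  show "eventually (\<lambda>i. (2 ^ i) powr \<sigma> * tail u (2 ^ i) \<le> tail u (2 ^ i)) sequentially"
  proof (rule always_eventually, rule allI)
    fix i :: nat
    have "(2 ^ i :: real) powr \<sigma> \<le> (2 ^ i) powr 0"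
      using \<open>\<sigma> \<le> 0\<close> by (intro powr_mono) auto
    then show "(2 ^ i) powr \<sigma> * tail u (2 ^ i) \<le> tail u (2 ^ i)"
      using tail_nonneg[of u "2 ^ i"] by (simp add: mult_left_le_one_le)
  qed
  show "(\<lambda>i. tail u (2 ^ i)) \<longlonglongrightarrow> 0"
    unfolding tail_def by (rule tail_integral_tendsto_0[OF f_int sol_D(1)[OF s] filterlim_two_power])
qed simp

text \<open>Young's inequality with exponents \<open>m / (m - 1)\<close> and \<open>m\<close> makes
  \<open>u x powr \<sigma> * f x\<close> integrable, and above height t this function dominates
  \<open>t powr \<sigma> * f x\<close>.\<close>

lemma decays_if_integrable:
  assumes s: "sol u v" and "0 < \<sigma>" and m: "1 < m" and fm: "integrable M (\<lambda>x. \<bar>f x\<bar> powr m)"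
    and um: "integrable M (\<lambda>x. u x powr (m * \<sigma> / (m - 1)))"
  shows "decays u"
  unfolding decays_def
proof (rule tendsto_sandwich)
  note [measurable] = sol_D(1)[OF s]
  have i: "integrable M (\<lambda>x. u x powr \<sigma> * f x)"
  proof (rule Bochner_Integration.integrable_bound)
    show "integrable M (\<lambda>x. u x powr (m * \<sigma> / (m - 1)) + \<bar>f x\<bar> powr m)" using fm um by simp
    show "AE x in M. norm (u x powr \<sigma> * f x) \<le> norm (u x powr (m * \<sigma> / (m - 1)) + \<bar>f x\<bar> powr m)"
    proof (rule AE_I2)
      fix x
      have "u x powr \<sigma> * \<bar>f x\<bar> \<le> (u x powr \<sigma>) powr (m / (m - 1)) + \<bar>f x\<bar> powr m"
        using m by (intro young_powr) auto
      then show "norm (u x powr \<sigma> * f x) \<le> norm (u x powr (m * \<sigma> / (m - 1)) + \<bar>f x\<bar> powr m)"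
        by (simp add: abs_mult powr_powr mult.commute)
    qed
  qed measurable
  show "eventually (\<lambda>i. 0 \<le> (2 ^ i) powr \<sigma> * tail u (2 ^ i)) sequentially"
    using tail_nonneg by simp
  show "eventually (\<lambda>i. (2 ^ i) powr \<sigma> * tail u (2 ^ i) \<le> (\<integral>x. (if 2 ^ i < u x then u x powr \<sigma> * f x else 0) \<partial>M)) sequentially"
  proof (rule always_eventually, rule allI)
    fix n :: nat
    have "(2 ^ n) powr \<sigma> * tail u (2 ^ n) = (\<integral>x. (2 ^ n) powr \<sigma> * (if 2 ^ n < u x then f x else 0) \<partial>M)"
      by (simp add: tail_def)
    also have "\<dots> \<le> (\<integral>x. (if 2 ^ n < u x then u x powr \<sigma> * f x else 0) \<partial>M)"
    proof (rule integral_mono_AE)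
      show "integrable M (\<lambda>x. (2 ^ n) powr \<sigma> * (if 2 ^ n < u x then f x else 0))"
        by (intro integrable_mult_right tail_integrable sol_D(1)[OF s])
      show "integrable M (\<lambda>x. if 2 ^ n < u x then u x powr \<sigma> * f x else 0)"
      proof (rule Bochner_Integration.integrable_bound[OF i])
        show "(\<lambda>x. if 2 ^ n < u x then u x powr \<sigma> * f x else 0) \<in> borel_measurable M" by measurable
      qed auto
      show "AE x in M. (2 ^ n) powr \<sigma> * (if 2 ^ n < u x then f x else 0) \<le> (if 2 ^ n < u x then u x powr \<sigma> * f x else 0)"
        using f_pos
      proof eventually_elim
        case (elim x)
        have "(2 ^ n) powr \<sigma> \<le> u x powr \<sigma>" if "2 ^ n < u x"
          using that \<open>0 < \<sigma>\<close> by (intro powr_mono2) auto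
        then show ?case using elim by (auto intro!: mult_right_mono)
      qed
    qed
    finally show "(2 ^ n) powr \<sigma> * tail u (2 ^ n) \<le> (\<integral>x. (if 2 ^ n < u x then u x powr \<sigma> * f x else 0) \<partial>M)" .
  qed
  show "(\<lambda>n. \<integral>x. (if 2 ^ n < u x then u x powr \<sigma> * f x else 0) \<partial>M) \<longlonglongrightarrow> 0"
    by (rule tail_integral_tendsto_0[OF i sol_D(1)[OF s] filterlim_two_power])
qed simp

text \<open>The exponent \<open>q\<close> is the one with
  \<open>1 - 1 / q = \<kappa> * \<sigma> / (p - 1)\<close>, so Hoelder bounds
  \<open>\<Phi> t\<close> by \<open>\<epsilon> t\<close> times the power
  \<open>\<sigma> / (p - 1)\<close> of \<open>y t\<close>, the quantity that the Sobolev inequality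
  controls. Since \<open>\<sigma> \<le> p - 1\<close>, that power is at most \<open>1 + y t\<close>,
  and \<open>y (2 * t) \<le> C * \<Phi> t\<close> closes the recurrence.\<close>

lemma decays_if_high_integrability:
  fixes q :: real
  defines "N \<equiv> real DIM('a)"
  assumes s: "sol u v" and \<sigma>: "0 < \<sigma>" "\<sigma> \<le> p - 1"
    and q: "q = N * (p - 1) / (N * (p - 1) - (N - p) * \<sigma>)" and fq: "integrable M (\<lambda>x. \<bar>f x\<bar> powr q)"
  shows "decays u"
proof -
  note [measurable] = sol_D(1,2)[OF s]
  interpret finite_measure M by (rule finite_measure_M)
  have N: "0 < N" "0 < N - p" using p by (auto simp: N_def)
  define \<kappa> where "\<kappa> = (N - p) / N"
  have \<kappa>: "0 < \<kappa>" using N by (simp add: \<kappa>_def)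
  have den: "0 < N * (p - 1) - (N - p) * \<sigma>"
  proof -
    have "(N - p) * \<sigma> \<le> (N - p) * (p - 1)" using N \<sigma> by (intro mult_left_mono) auto
    also have "\<dots> < N * (p - 1)" using p by (intro mult_strict_right_mono) auto
    finally show ?thesis by simp
  qed
  have q1: "1 < q" using den N \<sigma> p by (simp add: q)
  have q': "1 - 1 / q = \<kappa> * \<sigma> / (p - 1)"
  proof -
    have "1 - 1 / q = (N - p) * \<sigma> / (N * (p - 1))"
      using den N p by (simp add: q diff_divide_distrib)
    then show ?thesis by (simp add: \<kappa>_def)
  qed
  define \<mu> where "\<mu> t = measure M {x \<in> \<Omega>. t < u x}" for t
  define y where "y t = t powr (p - 1) * \<mu> t powr \<kappa>" for t
  have y0: "0 \<le> y t" for t by (simp add: y_def)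
  define \<Phi> where "\<Phi> t = t powr \<sigma> * tail u t" for t
  have \<Phi>0: "0 \<le> \<Phi> t" for t using tail_nonneg by (simp add: \<Phi>_def)
  define \<epsilon> where "\<epsilon> t = (\<integral>x. (if t < u x then \<bar>f x\<bar> powr q else 0) \<partial>M) powr (1 / q)" for t
  have \<epsilon>0: "0 \<le> \<epsilon> t" for t by (simp add: \<epsilon>_def)
  have holder: "\<Phi> t \<le> 2 * \<epsilon> t * (1 + y t)" if "0 < t" for t
  proof -
    have "tail u t \<le> 2 * \<epsilon> t * \<mu> t powr (1 - 1 / q)"
      using integral_le_powr_measure[OF q1 f_int fq, of "\<lambda>x. t < u x"]
      by (simp add: tail_def \<epsilon>_def \<mu>_def)
    then have "\<Phi> t \<le> t powr \<sigma> * (2 * \<epsilon> t * \<mu> t powr (1 - 1 / q))"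
      unfolding \<Phi>_def by (intro mult_left_mono) auto
    also have "t powr \<sigma> * (2 * \<epsilon> t * \<mu> t powr (1 - 1 / q)) = 2 * \<epsilon> t * y t powr (\<sigma> / (p - 1))"
      using that p \<sigma> by (simp add: y_def powr_mult powr_powr q')
    also have "\<dots> \<le> 2 * \<epsilon> t * (1 + y t)"
    proof (rule mult_left_mono)
      show "y t powr (\<sigma> / (p - 1)) \<le> 1 + y t"
      proof (cases "y t \<le> 1")
        case True
        then have "y t powr (\<sigma> / (p - 1)) \<le> 1" using y0 \<sigma> p by (intro powr_le1) auto
        then show ?thesis using y0[of t] by linarith
      next
        case False
        then have "y t powr (\<sigma> / (p - 1)) \<le> y t powr 1"
          using \<sigma> p by (intro powr_mono) auto
        then show ?thesis using False by simp
      qed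
    qed (use \<epsilon>0 in auto)
    finally show ?thesis .
  qed
  obtain S where S: "0 < S" and sob:
    "\<And>\<Omega> w1 w2 g1 g2 t. open \<Omega> \<Longrightarrow> bounded \<Omega> \<Longrightarrow> W01p0 \<Omega> p w1 g1 \<Longrightarrow> W01p0 \<Omega> p w2 g2 \<Longrightarrow> t > 0 \<Longrightarrow>
      t powr p * measure (lebesgue_on \<Omega>) {x \<in> \<Omega>. 2 * t \<le> \<bar>w1 x - w2 x\<bar>} powr ((real DIM('a) - p) / real DIM('a))
        \<le> S * (\<integral>x. norm (g1 x - g2 x :: 'a) powr p \<partial>lebesgue_on \<Omega>)"
    using weak_sobolev_W01p0[OF p] by blast
  \<comment> \<open>The two powers of 2 come from writing \<open>(2 * t) powr (p - 1)\<close> as a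
    multiple of \<open>(t / 2) powr p / t\<close>.\<close>
  define C where "C = 2 powr (p - 1) * 2 powr p * S * C\<^sub>E"
  have C: "0 < C" using S C\<^sub>E_pos by (simp add: C_def)
  have sobolev: "y (2 * t) \<le> C * \<Phi> t" if t: "1 \<le> t" "s\<^sub>2 \<le> t" for t
  proof -
    \<comment> \<open>\<open>?w\<close> equals \<open>t\<close> where \<open>u\<close> exceeds
      \<open>2 * t\<close>, and its gradient lives between \<open>t\<close> and
      \<open>2 * t\<close>. The level is \<open>t / 2\<close> because the Sobolev estimate measures
      the set at twice its level.\<close>
    let ?w = "\<lambda>x. trunc (2 * t) (u x) - trunc t (u x)"
    let ?g = "\<lambda>x. (if \<bar>u x\<bar> \<le> 2 * t then v x else 0) - (if \<bar>u x\<bar> \<le> t then v x else 0)"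
    let ?E = "{x \<in> \<Omega>. 2 * (t / 2) \<le> \<bar>?w x\<bar>}"
    have t0: "0 < t" "0 < 2 * t" "0 < t / 2" using t by auto
    have "\<mu> (2 * t) \<le> measure M ?E"
      unfolding \<mu>_def
    proof (rule finite_measure_mono)
      show "{x \<in> \<Omega>. 2 * t < u x} \<subseteq> ?E" using t0 by (auto simp: trunc_def)
      have "{x \<in> space M. 2 * (t / 2) \<le> \<bar>?w x\<bar>} \<in> sets M" unfolding trunc_def by measurable
      then show "?E \<in> sets M" by (simp only: space_M)
    qed
    then have "(t / 2) powr p * \<mu> (2 * t) powr \<kappa> \<le> (t / 2) powr p * measure M ?E powr \<kappa>"
      using \<kappa> by (intro mult_left_mono powr_mono2) (auto simp: \<mu>_def)
    also have "\<dots> \<le> S * (\<integral>x. norm (?g x) powr p \<partial>M)"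
      unfolding \<kappa>_def N_def by (rule sob[OF \<Omega> sol_D(4)[OF s t0(2)] sol_D(4)[OF s t0(1)] t0(3)])
    also have "\<dots> \<le> S * (\<integral>x. (if t < u x \<and> u x \<le> 4 * t then norm (v x) powr p else 0) \<partial>M)"
    proof (intro mult_left_mono integral_mono_AE)
      have "Lp_fun M p ?g"
        using sol_D(4)[OF s t0(2)] sol_D(4)[OF s t0(1)] p by (intro Lp_fun_diff) (simp_all add: W01p0_def)
      then show "integrable M (\<lambda>x. norm (?g x) powr p)" by (simp add: Lp_fun_def)
      show "integrable M (\<lambda>x. if t < u x \<and> u x \<le> 4 * t then norm (v x) powr p else 0)"
        by (rule energy_estimate(2)[OF s t])
      show "AE x in M. norm (?g x) powr p \<le> (if t < u x \<and> u x \<le> 4 * t then norm (v x) powr p else 0)"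
        using sol_D(3)[OF s] by eventually_elim (use t0 in auto)
    qed (use S in auto)
    also have "\<dots> \<le> S * (C\<^sub>E * t * \<Phi> t)"
      using energy_estimate(1)[OF s t] S by (intro mult_left_mono) (auto simp: \<Phi>_def)
    finally have "(t / 2) powr p * \<mu> (2 * t) powr \<kappa> \<le> S * (C\<^sub>E * t * \<Phi> t)" .
    moreover have "y (2 * t) = 2 powr (p - 1) * 2 powr p / t * ((t / 2) powr p * \<mu> (2 * t) powr \<kappa>)"
      using t0 by (simp add: y_def powr_mult powr_divide powr_diff)
    ultimately have "y (2 * t) \<le> 2 powr (p - 1) * 2 powr p / t * (S * (C\<^sub>E * t * \<Phi> t))"
      using t0 by (simp only:) (intro mult_left_mono, auto)
    also have "\<dots> = C * \<Phi> t" using t0 by (simp add: C_def)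
    finally show ?thesis .
  qed
  have "(\<lambda>i. \<Phi> (2 ^ i)) \<longlonglongrightarrow> 0"
  proof (rule affine_recurrence_tendsto_0[where \<delta> = "\<lambda>i. 2 * \<epsilon> (2 ^ Suc i)"])
    show "0 \<le> \<Phi> (2 ^ i)" for i by (rule \<Phi>0)
    show "0 \<le> C" using C by simp
    have "(\<lambda>i. \<integral>x. (if 2 ^ i < u x then \<bar>f x\<bar> powr q else 0) \<partial>M) \<longlonglongrightarrow> 0"
      by (rule tail_integral_tendsto_0[OF fq sol_D(1)[OF s] filterlim_two_power])
    then have "(\<lambda>i. \<epsilon> (2 ^ i)) \<longlonglongrightarrow> 0 powr (1 / q)"
      unfolding \<epsilon>_def using q1
      by (intro tendsto_powr' tendsto_const) (auto intro!: always_eventually Bochner_Integration.integral_nonneg)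
    then have "(\<lambda>i. \<epsilon> (2 ^ i)) \<longlonglongrightarrow> 0" by simp
    from tendsto_mult[OF tendsto_const[of 2] LIMSEQ_Suc[OF this]]
    show "(\<lambda>i. 2 * \<epsilon> (2 ^ Suc i)) \<longlonglongrightarrow> 0" by simp
    have "eventually (\<lambda>i. max 1 s\<^sub>2 \<le> (2 ^ i :: real)) sequentially"
      using filterlim_two_power by (simp add: filterlim_at_top)
    then show "eventually (\<lambda>i. \<Phi> (2 ^ Suc i) \<le> 2 * \<epsilon> (2 ^ Suc i) * (1 + C * \<Phi> (2 ^ i))) sequentially"
    proof eventually_elim
      case (elim i)
      have "\<Phi> (2 ^ Suc i) \<le> 2 * \<epsilon> (2 ^ Suc i) * (1 + y (2 ^ Suc i))"
        by (rule holder) simp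
      also have "\<dots> \<le> 2 * \<epsilon> (2 ^ Suc i) * (1 + C * \<Phi> (2 ^ i))"
        using sobolev[of "2 ^ i"] elim \<epsilon>0 by (intro mult_left_mono add_left_mono) auto
      finally show ?case .
    qed
  qed
  then show ?thesis by (simp add: decays_def \<Phi>_def)
qed

text \<open>At fixed \<open>n\<close>, growing \<open>m\<close> removes \<open>Z1\<close> by
  dominated convergence, since no point satisfies
  \<open>0 < \<bar>u1 x - u2 x\<bar> \<le> n / m\<close> for all \<open>m\<close>. The gap is
  nonnegative almost everywhere with integral at most 0, so it vanishes where both solutions are at
  most \<open>n0\<close>, and these sets exhaust \<open>\<Omega>\<close>.\<close>

lemma unique_if_decays:
  assumes s1: "sol u1 v1" and s2: "sol u2 v2" and d: "decays u1" "decays u2"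
  shows "AE x in M. u1 x = u2 x"
proof -
  note [measurable] = sol_D(1,2)[OF s1] sol_D(1,2)[OF s2]
  define Z where "Z x = l x powr (p / (p - 1)) + norm (v1 x) powr p + norm (v2 x) powr p" for x
  have Z0: "0 \<le> Z x" for x by (simp add: Z_def)
  define D where "D n0 x = (if u1 x \<le> n0 \<and> u2 x \<le> n0 then f x * (H (u2 x) - H (u1 x)) * trunc 1 (u1 x - u2 x) else 0)" for n0 x
  define Z1 where "Z1 n m x = (if u1 x \<le> 2 * n \<and> u2 x \<le> 2 * n \<and> u1 x \<noteq> u2 x \<and> \<bar>u1 x - u2 x\<bar> \<le> n / real m then Z x else 0)" for n m x
  define Z2 where "Z2 n x = (if n / 2 < u1 x \<and> u1 x \<le> 2 * n \<and> n / 2 < u2 x \<and> u2 x \<le> 2 * n then Z x else 0)" for n x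
  note gap = weighted_gap_inequality[OF s1 s2, folded Z_def, folded D_def Z1_def Z2_def]
  have [measurable]: "Z \<in> borel_measurable M" "Z1 n m \<in> borel_measurable M" for n m
    unfolding Z_def[abs_def] Z1_def[abs_def] by measurable
  define \<Lambda> where "\<Lambda> = (\<integral>x. \<bar>l x\<bar> powr (p / (p - 1)) \<partial>M)"
  have li: "integrable M (\<lambda>x. \<bar>l x\<bar> powr (p / (p - 1)))" using l(2) by (simp add: Lp_fun_def)
  have B0: "0 \<le> B" using b_pos[of 0] b_bound[of 0] by linarith
  have step1: "(\<integral>x. D n0 x \<partial>M) \<le> H 1 * (tail u1 n + tail u2 n) + 8 * \<beta> * B / n * (\<integral>x. Z2 n x \<partial>M)"
    if n: "1 \<le> n" "n0 \<le> n" for n n0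
  proof -
    \<comment> \<open>The margin 3 secures \<open>m > 2\<close> and \<open>n \<le> m\<close> for
      every \<open>m\<close> from \<open>m0\<close> on; as \<open>n / m\<close> decreases in
      \<open>m\<close>, \<open>Z1 n m0\<close> is a majorant.\<close>
    obtain m0 where m0: "n + 3 \<le> real m0" using real_arch_simple by blast
    have mm: "2 < m0 + i" "n \<le> real (m0 + i)" for i using m0 n by auto
    have "(\<lambda>i. \<integral>x. Z1 n (m0 + i) x \<partial>M) \<longlonglongrightarrow> (\<integral>x. 0 \<partial>M)"
    proof (rule integral_dominated_convergence[where w = "Z1 n m0"])
      show "integrable M (Z1 n m0)" using gap(2)[OF n mm, of 0] by simp
      show "AE x in M. (\<lambda>i. Z1 n (m0 + i) x) \<longlonglongrightarrow> 0"
      proof (rule AE_I2)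
        fix x
        show "(\<lambda>i. Z1 n (m0 + i) x) \<longlonglongrightarrow> 0"
        proof (cases "u1 x = u2 x")
          case False
          obtain i0 where i0: "n / \<bar>u1 x - u2 x\<bar> < real i0" using reals_Archimedean2 by blast
          have "Z1 n (m0 + i) x = 0" if "i \<ge> i0" for i
          proof -
            have "n / \<bar>u1 x - u2 x\<bar> < real (m0 + i)" using i0 that by linarith
            then have "n / real (m0 + i) < \<bar>u1 x - u2 x\<bar>"
              using False mm(1)[of i] by (simp add: field_simps)
            then show ?thesis by (simp add: Z1_def)
          qed
          then show ?thesis by (intro tendsto_eventually) (auto simp: eventually_sequentially)
        qed (simp add: Z1_def)
      qed
      show "AE x in M. norm (Z1 n (m0 + i) x) \<le> Z1 n m0 x" for i
      proof (rule AE_I2)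
        fix x
        have "n / real (m0 + i) \<le> n / real m0"
          using m0 n by (intro divide_left_mono) auto
        then show "norm (Z1 n (m0 + i) x) \<le> Z1 n m0 x" using Z0[of x] by (auto simp: Z1_def)
      qed
    qed auto
    then have "(\<lambda>i. H 1 * (tail u1 n + tail u2 n) + 4 * \<beta> * L * (\<integral>x. Z1 n (m0 + i) x \<partial>M) + 8 * \<beta> * B / n * (\<integral>x. Z2 n x \<partial>M))
      \<longlonglongrightarrow> H 1 * (tail u1 n + tail u2 n) + 4 * \<beta> * L * (\<integral>x. 0 \<partial>M) + 8 * \<beta> * B / n * (\<integral>x. Z2 n x \<partial>M)"
      by (intro tendsto_intros)
    then have "(\<integral>x. D n0 x \<partial>M) \<le> H 1 * (tail u1 n + tail u2 n) + 4 * \<beta> * L * (\<integral>x. 0 \<partial>M) + 8 * \<beta> * B / n * (\<integral>x. Z2 n x \<partial>M)"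
      by (rule LIMSEQ_le_const) (use gap(4)[OF n mm] in auto)
    then show ?thesis by simp
  qed
  have step2: "(\<integral>x. D n0 x \<partial>M) \<le> 0" for n0
  proof -
    \<comment> \<open>The right side of \<open>step1\<close> at \<open>n = 2 ^ Suc i\<close> with
      the energy estimate at \<open>t = 2 ^ i\<close> inserted; \<open>C\<^sub>E / 2\<close> is
      \<open>C\<^sub>E * t\<close> divided by \<open>n = 2 * t\<close>.\<close>
    define r where "r i = H 1 * (tail u1 (2 ^ Suc i) + tail u2 (2 ^ Suc i)) + 8 * \<beta> * B *
      (\<Lambda> * inverse (2 ^ Suc i) + C\<^sub>E / 2 * ((2 ^ i) powr \<sigma> * tail u1 (2 ^ i) + (2 ^ i) powr \<sigma> * tail u2 (2 ^ i)))" for i :: nat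
    have tl: "(\<lambda>i. tail u (2 ^ i)) \<longlonglongrightarrow> 0" if "sol u v" for u v
      unfolding tail_def by (rule tail_integral_tendsto_0[OF f_int sol_D(1)[OF that] filterlim_two_power])
    have iv: "(\<lambda>i. inverse (2 ^ i :: real)) \<longlonglongrightarrow> 0"
      by (rule tendsto_inverse_0_at_top[OF filterlim_two_power])
    have "r \<longlonglongrightarrow> H 1 * (0 + 0) + 8 * \<beta> * B * (\<Lambda> * 0 + C\<^sub>E / 2 * (0 + 0))"
      unfolding r_def using d
      by (intro tendsto_intros LIMSEQ_Suc[OF tl[OF s1]] LIMSEQ_Suc[OF tl[OF s2]] LIMSEQ_Suc[OF iv])
        (simp_all add: decays_def)
    then have r: "r \<longlonglongrightarrow> 0" by simp
    have "eventually (\<lambda>i. max (max 1 s\<^sub>2) n0 \<le> (2 ^ i :: real)) sequentially"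
      using filterlim_two_power unfolding filterlim_at_top by blast
    then have "eventually (\<lambda>i. (\<integral>x. D n0 x \<partial>M) \<le> r i) sequentially"
    proof eventually_elim
      case (elim i)
      define t where "t = (2 ^ i :: real)"
      have t: "1 \<le> t" "s\<^sub>2 \<le> t" "n0 \<le> t" using elim by (auto simp: t_def)
      have n: "1 \<le> 2 * t" "n0 \<le> 2 * t" using t by auto
      let ?e = "\<lambda>u v x. if t < u x \<and> u x \<le> 4 * t then norm (v x :: 'a) powr p else 0"
      have "(\<integral>x. Z2 (2 * t) x \<partial>M) \<le> (\<integral>x. \<bar>l x\<bar> powr (p / (p - 1)) + ?e u1 v1 x + ?e u2 v2 x \<partial>M)"
      proof (rule integral_mono_AE)
        show "integrable M (Z2 (2 * t))"
        proof -
          obtain m0 where "2 * t + 3 \<le> real m0" using real_arch_simple by blast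
          then show ?thesis using gap(3)[OF n, of m0] t by simp
        qed
        show "integrable M (\<lambda>x. \<bar>l x\<bar> powr (p / (p - 1)) + ?e u1 v1 x + ?e u2 v2 x)"
          by (intro Bochner_Integration.integrable_add li energy_estimate(2)[OF s1] energy_estimate(2)[OF s2] t)
        show "AE x in M. Z2 (2 * t) x \<le> \<bar>l x\<bar> powr (p / (p - 1)) + ?e u1 v1 x + ?e u2 v2 x"
          using AE_space by eventually_elim (use l(1) in \<open>auto simp: Z2_def Z_def\<close>)
      qed
      also have "\<dots> = \<Lambda> + (\<integral>x. ?e u1 v1 x \<partial>M) + (\<integral>x. ?e u2 v2 x \<partial>M)"
        using li energy_estimate(2)[OF s1 t(1,2)] energy_estimate(2)[OF s2 t(1,2)] by (simp add: \<Lambda>_def)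
      also have "\<dots> \<le> \<Lambda> + C\<^sub>E * t * (t powr \<sigma> * tail u1 t) + C\<^sub>E * t * (t powr \<sigma> * tail u2 t)"
        using energy_estimate(1)[OF s1 t(1,2)] energy_estimate(1)[OF s2 t(1,2)] by linarith
      finally have Z2: "(\<integral>x. Z2 (2 * t) x \<partial>M) \<le> \<Lambda> + C\<^sub>E * t * (t powr \<sigma> * tail u1 t) + C\<^sub>E * t * (t powr \<sigma> * tail u2 t)" .
      have "(\<integral>x. D n0 x \<partial>M) \<le> H 1 * (tail u1 (2 * t) + tail u2 (2 * t)) + 8 * \<beta> * B / (2 * t) * (\<integral>x. Z2 (2 * t) x \<partial>M)"
        by (rule step1[OF n])
      also have "\<dots> \<le> H 1 * (tail u1 (2 * t) + tail u2 (2 * t)) + 8 * \<beta> * B / (2 * t) *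
          (\<Lambda> + C\<^sub>E * t * (t powr \<sigma> * tail u1 t) + C\<^sub>E * t * (t powr \<sigma> * tail u2 t))"
        using Z2 \<beta> B0 t by (intro add_left_mono mult_left_mono) auto
      also have "\<dots> = r i"
        using t by (simp add: r_def t_def[symmetric] field_simps)
      finally show ?case .
    qed
    then show ?thesis
      using tendsto_lowerbound[OF r] by simp
  qed
  have ae: "AE x in M. u1 x \<le> real n0 \<and> u2 x \<le> real n0 \<longrightarrow> u1 x = u2 x" for n0 :: nat
  proof -
    have pos: "AE x in M. 0 \<le> D (real n0) x \<and> (D (real n0) x = 0 \<and> u1 x \<le> real n0 \<and> u2 x \<le> real n0 \<longrightarrow> u1 x = u2 x)"
      using no_infinite_source[OF s1 s2] no_infinite_source[OF s2 s1] f_pos sol_D(3)[OF s1] sol_D(3)[OF s2]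
    proof eventually_elim
      case (elim x)
      consider "u1 x < u2 x" | "u2 x < u1 x" | "u1 x = u2 x" by linarith
      then have "u1 x = u2 x \<or> 0 < f x * (H (u2 x) - H (u1 x)) * trunc 1 (u1 x - u2 x)"
      proof cases
        case 1
        then have "H (u2 x) < H (u1 x)" using elim by (intro H_less) auto
        moreover have "trunc 1 (u1 x - u2 x) < 0" using 1 by (simp add: trunc_def)
        ultimately show ?thesis using elim by (intro disjI2 mult_neg_neg mult_pos_neg) auto
      next
        case 2
        then have "H (u1 x) < H (u2 x)" using elim by (intro H_less) auto
        moreover have "0 < trunc 1 (u1 x - u2 x)" using 2 by (simp add: trunc_def)
        ultimately show ?thesis using elim by (intro disjI2 mult_pos_pos) auto
      qed simp
      then show ?case by (auto simp: D_def trunc_def less_imp_le)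
    qed
    obtain m0 where "real n0 + 3 \<le> real m0" using real_arch_simple by blast
    then have Di: "integrable M (D (real n0))" using gap(1)[of "real n0 + 1" "real n0" m0] by simp
    have p1: "AE x in M. 0 \<le> D (real n0) x" using pos by eventually_elim blast
    have "(\<integral>x. D (real n0) x \<partial>M) = 0"
      using step2[of "real n0"] integral_nonneg_AE[OF p1] by linarith
    then have "AE x in M. D (real n0) x = 0"
      using integral_nonneg_eq_0_iff_AE[OF Di p1] by simp
    with pos show ?thesis by eventually_elim blast
  qed
  then have "AE x in M. \<forall>n0::nat. u1 x \<le> real n0 \<and> u2 x \<le> real n0 \<longrightarrow> u1 x = u2 x"
    unfolding AE_all_countable by blast
  then show ?thesis
  proof eventually_elim
    case (elim x)
    obtain n0 :: nat where "max (u1 x) (u2 x) \<le> real n0" using real_arch_simple by blast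
    then have "u1 x \<le> real n0 \<and> u2 x \<le> real n0" by simp
    then show ?case using elim by blast
  qed
qed

end

section \<open>Summability exponents and assembly of the three cases\<close>

lemma integrable_powr_le_exponent:
  fixes f :: "'b \<Rightarrow> real"
  assumes "finite_measure M" "0 \<le> r" "r \<le> m" "f \<in> borel_measurable M" "integrable M (\<lambda>x. \<bar>f x\<bar> powr m)"
  shows "integrable M (\<lambda>x. \<bar>f x\<bar> powr r)"
proof (rule Bochner_Integration.integrable_bound)
  interpret finite_measure M by fact
  note [measurable] = assms(4)
  show "integrable M (\<lambda>x. 1 + \<bar>f x\<bar> powr m)" using assms by simp
  show "(\<lambda>x. \<bar>f x\<bar> powr r) \<in> borel_measurable M" by measurable
  show "AE x in M. norm (\<bar>f x\<bar> powr r) \<le> norm (1 + \<bar>f x\<bar> powr m)"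
  proof (rule AE_I2)
    fix x
    show "norm (\<bar>f x\<bar> powr r) \<le> norm (1 + \<bar>f x\<bar> powr m)"
    proof (cases "\<bar>f x\<bar> \<le> 1")
      case True
      then have "\<bar>f x\<bar> powr r \<le> 1" using assms by (intro powr_le1) auto
      moreover have "0 \<le> \<bar>f x\<bar> powr r" "0 \<le> \<bar>f x\<bar> powr m" by auto
      ultimately show ?thesis unfolding real_norm_def by linarith
    next
      case False
      then have "\<bar>f x\<bar> powr r \<le> \<bar>f x\<bar> powr m" using assms by (intro powr_mono) auto
      then show ?thesis by simp
    qed
  qed
qed

theorem mainTheorem2:
  fixes \<Omega> :: "'a::euclidean_space set"
    and p \<beta> \<alpha> \<theta> \<gamma>\<^sub>2 c\<^sub>2 s\<^sub>2 m :: real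
    and A :: "'a \<Rightarrow> 'a \<Rightarrow> 'a" and l :: "'a \<Rightarrow> real"
    and b :: "real \<Rightarrow> real" and h :: "real \<Rightarrow> ereal" and f :: "'a \<Rightarrow> real"
  assumes dim: "DIM('a) \<ge> 2"
    and \<Omega>: "open \<Omega>" "bounded \<Omega>"
    and p: "1 < p" "p < real DIM('a)"
    \<comment> \<open>(U)\<close>
    and A_meas: "\<forall>\<xi>. (\<lambda>x. A x \<xi>) \<in> borel_measurable (lebesgue_on \<Omega>)"
    and A_cont: "AE x in lebesgue_on \<Omega>. continuous_on UNIV (A x)"
    and l: "\<forall>x\<in>\<Omega>. 0 \<le> l x" "Lp_fun (lebesgue_on \<Omega>) (p / (p - 1)) l"
    and \<beta>: "\<beta> > 0"
    and A_U: "AE x in lebesgue_on \<Omega>. \<forall>\<xi> \<xi>'.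
                 A x \<xi> \<bullet> \<xi> \<ge> norm \<xi> powr p
               \<and> norm (A x \<xi>) \<le> \<beta> * (l x + norm \<xi> powr (p - 1))
               \<and> (\<xi> \<noteq> \<xi>' \<longrightarrow> (A x \<xi> - A x \<xi>') \<bullet> (\<xi> - \<xi>') > 0)"
    \<comment> \<open>b bounded, Lipschitz, (B)\<close>
    and b_bdd: "bounded (range b)"
    and b_lip: "\<exists>L. L-lipschitz_on UNIV b"
    and \<alpha>: "\<alpha> > 0" and \<theta>: "\<theta> \<ge> 0"
    and b_B: "\<forall>s. b s \<ge> \<alpha> * (1 + \<bar>s\<bar>) powr (- \<theta> * (p - 1))"
    \<comment> \<open>h : [0,\<infinity>) \<rightarrow> [0,\<infinity>], continuous, finite on (0,\<infinity>), strictly decreasing, (H2)\<close>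
    and h_nonneg: "\<forall>s\<ge>0. h s \<ge> 0"
    and h_cont: "continuous_on {0..} h"
    and h_fin: "\<forall>s>0. h s < \<infinity>"
    and h_decr: "\<forall>s t. 0 \<le> s \<longrightarrow> s < t \<longrightarrow> h t < h s"
    and H2: "\<gamma>\<^sub>2 \<ge> 0" "c\<^sub>2 > 0" "s\<^sub>2 > 0"
            "\<forall>s\<ge>s\<^sub>2. h s \<le> ereal (c\<^sub>2 * s powr (- \<gamma>\<^sub>2))"
    \<comment> \<open>f\<close>
    and m: "m \<ge> 1"
    and f_Lm: "Lp_fun (lebesgue_on \<Omega>) m f"
    and f_pos: "AE x in lebesgue_on \<Omega>. f x > 0"
  shows
    "(\<theta> \<le> \<gamma>\<^sub>2 / (p - 1) \<and> m = 1 \<longrightarrow>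
        (\<forall>u1 u2. entropy_solution \<Omega> p A b h f u1 \<and> entropy_solution \<Omega> p A b h f u2
           \<longrightarrow> (AE x in lebesgue_on \<Omega>. u1 x = u2 x)))
   \<and> (\<theta> > \<gamma>\<^sub>2 / (p - 1) \<and> m > 1 \<longrightarrow>
        (\<forall>u1 u2. entropy_solution \<Omega> p A b h f u1
             \<and> integrable (lebesgue_on \<Omega>) (\<lambda>x. u1 x powr (m * (\<theta> * (p - 1) - \<gamma>\<^sub>2) / (m - 1)))
             \<and> entropy_solution \<Omega> p A b h f u2
             \<and> integrable (lebesgue_on \<Omega>) (\<lambda>x. u2 x powr (m * (\<theta> * (p - 1) - \<gamma>\<^sub>2) / (m - 1)))
           \<longrightarrow> (AE x in lebesgue_on \<Omega>. u1 x = u2 x)))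
   \<and> (\<theta> \<le> 1 + \<gamma>\<^sub>2 / (p - 1)
        \<and> m \<ge> max (real DIM('a) * (p - 1)
                     / ((real DIM('a) - p) * (\<gamma>\<^sub>2 - \<theta> * (p - 1)) + real DIM('a) * (p - 1))) 1
      \<longrightarrow>
        (\<forall>u1 u2. entropy_solution \<Omega> p A b h f u1 \<and> entropy_solution \<Omega> p A b h f u2
           \<longrightarrow> (AE x in lebesgue_on \<Omega>. u1 x = u2 x)))"
proof -
  let ?M = "lebesgue_on \<Omega>"
  have fin: "finite_measure ?M"
    using \<Omega> by (intro finite_measure_lebesgue_on bounded_set_imp_lmeasurable) auto
  have fm: "f \<in> borel_measurable ?M" "integrable ?M (\<lambda>x. \<bar>f x\<bar> powr m)"
    using f_Lm by (auto simp: Lp_fun_def)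
  have "integrable ?M (\<lambda>x. \<bar>f x\<bar> powr 1)"
    using integrable_powr_le_exponent[OF fin _ m fm] by simp
  then have f_int: "integrable ?M f" using fm(1) by (simp add: integrable_abs_iff)
  obtain L where L: "L-lipschitz_on UNIV b" using b_lip by blast
  obtain B where B: "\<And>s. \<bar>b s\<bar> \<le> B" using b_bdd by (auto simp: bounded_iff)
  interpret singular_problem \<Omega> p \<beta> \<alpha> \<theta> \<gamma>\<^sub>2 c\<^sub>2 s\<^sub>2 L B A l b h f
  proof
    show "b s \<le> B" for s using B[of s] by linarith
    show "\<bar>b s - b t\<bar> \<le> L * \<bar>s - t\<bar>" "0 \<le> L" for s t
      using L by (auto simp: lipschitz_on_def dist_real_def)
  qed (use assms f_int in auto)
  \<comment> \<open>\<open>P\<close> stands for the side condition of the class in which uniqueness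
    is claimed: the integrability of a power of \<open>u\<close> in (b), and \<open>True\<close> in
    (a) and (c).\<close>
  have uniq: "AE x in ?M. u1 x = u2 x"
    if "\<And>u v. P u \<Longrightarrow> entropy_pair \<Omega> p A b h f u v \<Longrightarrow> decays u"
      "P u1" "entropy_solution \<Omega> p A b h f u1" "P u2" "entropy_solution \<Omega> p A b h f u2" for P u1 u2
    using that unique_if_decays unfolding entropy_solution_iff_pair by blast
  have q: "\<sigma> = \<theta> * (p - 1) - \<gamma>\<^sub>2" by (simp add: \<sigma>_def)
  have le_iff: "\<theta> \<le> \<gamma>\<^sub>2 / (p - 1) \<longleftrightarrow> \<sigma> \<le> 0" using p by (simp add: q field_simps)
  have gt_iff: "\<theta> > \<gamma>\<^sub>2 / (p - 1) \<longleftrightarrow> 0 < \<sigma>" using p by (simp add: q field_simps)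
  have le1: "\<theta> \<le> 1 + \<gamma>\<^sub>2 / (p - 1) \<longleftrightarrow> \<sigma> \<le> p - 1" using p by (simp add: q field_simps)
  show ?thesis
    unfolding le_iff gt_iff le1 q[symmetric]
  proof (intro conjI impI allI; elim conjE)
    fix u1 u2
    assume "\<sigma> \<le> 0" and "entropy_solution \<Omega> p A b h f u1" "entropy_solution \<Omega> p A b h f u2"
    then show "AE x in ?M. u1 x = u2 x"
      using uniq[of "\<lambda>_. True"] decays_if_nonpos by blast
  next
    fix u1 u2
    assume *: "0 < \<sigma>" "1 < m" "entropy_solution \<Omega> p A b h f u1" "entropy_solution \<Omega> p A b h f u2"
      "integrable ?M (\<lambda>x. u1 x powr (m * \<sigma> / (m - 1)))" "integrable ?M (\<lambda>x. u2 x powr (m * \<sigma> / (m - 1)))"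
    show "AE x in ?M. u1 x = u2 x"
      by (rule uniq[of "\<lambda>u. integrable ?M (\<lambda>x. u x powr (m * \<sigma> / (m - 1)))"])
        (use * decays_if_integrable fm(2) in blast)+
  next
    fix u1 u2
    let ?N = "real DIM('a)"
    let ?r = "?N * (p - 1) / (?N * (p - 1) - (?N - p) * \<sigma>)"
    assume sp: "\<sigma> \<le> p - 1" and mm: "max (?N * (p - 1) / ((?N - p) * (\<gamma>\<^sub>2 - \<theta> * (p - 1)) + ?N * (p - 1))) 1 \<le> m"
      and e: "entropy_solution \<Omega> p A b h f u1" "entropy_solution \<Omega> p A b h f u2"
    have "(?N - p) * (\<gamma>\<^sub>2 - \<theta> * (p - 1)) + ?N * (p - 1) = ?N * (p - 1) - (?N - p) * \<sigma>"
      unfolding q by algebra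
    then have r: "?r \<le> m" using mm by simp
    show "AE x in ?M. u1 x = u2 x"
    \<comment> \<open>For \<open>\<sigma> \<le> 0\<close> the vanishing of the tails is enough.
      Otherwise finiteness of the measure lowers the exponent \<open>m\<close> of \<open>f\<close>
      to the exact value \<open>?r\<close> for which the recurrence closes.\<close>
    proof (cases "\<sigma> \<le> 0")
      case True
      then show ?thesis using uniq[of "\<lambda>_. True"] decays_if_nonpos e by blast
    next
      case False
      have "(?N - p) * \<sigma> \<le> (?N - p) * (p - 1)" using p sp by (intro mult_left_mono) auto
      also have "\<dots> \<le> ?N * (p - 1)" using p by (intro mult_right_mono) auto
      finally have "0 \<le> ?r" using p by (intro divide_nonneg_nonneg) auto
      then have "integrable ?M (\<lambda>x. \<bar>f x\<bar> powr ?r)"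
        by (rule integrable_powr_le_exponent[OF fin _ r fm])
      then show ?thesis
        using uniq[of "\<lambda>_. True"] decays_if_high_integrability[OF _ _ sp refl] False e by force
    qed
  qed
qed

end
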